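(* Let $e_1=1,e_2,\ldots,e_k\in\mathbb{A}_n^m$, $2\le k\le 2n$, be linearly independent over $\mathbb{R}$, let $E_k=\{\sum_{j=1}^k x_je_j : x_j\in\mathbb{R}\}$, and suppose that $$\{f_u(\zeta):\zeta\in E_k\}=\mathbb{C}\qquad\text{for every } u=1,2,\ldots,m .$$ Let $\Omega\subset E_k$ be an arbitrary domain and let $\Phi:\Omega\to\mathbb{A}_n^m$ be a function. Then the following properties are equivalent: (I) $\Phi$ is locally bounded and differentiable in the sense of G\^ateaux in $\Omega$; (II) $\Phi$ is monogenic in $\Omega$; (III) $\Phi$ is differentiable in the sense of Lorch in $\Omega$.
   Context: $\mathbb{A}_n^m$ denotes an arbitrary $n$-dimensional commutative associative algebra with unit $1$ over $\mathbb{C}$, written in a Cartan basis $\{I_r\}_{r=1}^n$, i.e. a basis for which there are $m\in\{1,\ldots,n\}$ and structure constants $\Upsilon_{r,k}^{s}\in\mathbb{C}$ such that: 1. for $r,s\in\{1,\ldots,m\}$: $I_rI_s=0$ if $r\ne s$ and $I_rI_r=I_r$; 2. for $r,s\in\{m+1,\ldots,n\}$: $I_rI_s=\sum_{k=\max\{r,s\}+1}^n\Upsilon_{r,k}^{s}I_k$; 3. for each $s\in\{m+1,\ldots,n\}$ there is a unique $u_s\in\{1,\ldots,m\}$ such that for all $r\in\{1,\ldots,m\}$: $I_rI_s=I_s$ if $r=u_s$ and $I_rI_s=0$ if $r\neq u_s$. Every such algebra has such a basis (E. Cartan). The unit is $1=I_1+\cdots+I_m$. The norm is $\|v\|=\sqrt{\sum_{j=1}^n|v_j|^2}$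 for $v=\sum_{j=1}^n v_jI_j$, $v_j\in\mathbb{C}$. For $u=1,\ldots,m$, $f_u:\mathbb{A}_n^m\to\mathbb{C}$ is the $\mathbb{C}$-linear functional with $f_u(I_u)=1$ and $f_u(I_r)=0$ for all $r\ne u$, $1\le r\le n$ (it is continuous and multiplicative). A domain in $E_k$ is a nonempty open connected subset of $E_k$ ($E_k$ being regarded as a $k$-dimensional real vector space with the norm above). A function is locally bounded in $\Omega$ if every point of $\Omega$ has a neighborhood in which it is bounded. $\Phi:\Omega\to\mathbb{A}_n^m$ is differentiable in the sense of G\^ateaux at $\zeta\in\Omega$ if there is an element $\Phi_G'(\zeta)\in\mathbb{A}_n^m$ such that $\lim_{\delta\to0^+}\frac{\Phi(\zeta+\delta h)-\Phi(\zeta)}{\delta}=h\,\Phi_G'(\zeta)$ for all $h\in E_k$. $\Phi$ is differentiable in the sense of Lorch at $\zeta\in\Omega$ if there is an element $\Phi_L'(\zeta)\in\mathbb{A}_n^m$ such that for each $\varepsilon>0$ there is $\delta>0$ such that for all $h\in E_k$ with $\|h\|<\delta$ (and $\zeta+h\in\Omega$), $\|\Phi(\zeta+h)-\Phi(\zeta)-h\Phi_L'(\zeta)\|\le\|h\|\,\varepsilon$. Differentiability (in either sense) in $\Omega$ means at every point of $\Omega$. $\Phi$ is monogenic in $\Omega$ if it is continuous and differentiable in the sense of G\^ateaux at every point of $\Omega$. *)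

theory Defs
  imports "HOL-Analysis.Analysis"
begin

text \<open>
  The algebra is the whole type \<open>'a\<close>: ring operations and unit come from \<open>comm_ring_1\<close>,
  norm and topology from \<open>real_normed_vector\<close>, and \<open>cscale\<close> is the multiplication by complex
  scalars. The axiom \<open>norm_eq\<close> says that the norm of the type is the Euclidean norm of the
  coordinates in the Cartan basis \<open>I 1, \<dots>, I n\<close>. Inside the locale \<open>span\<close> and
  \<open>independent\<close> refer to complex scalars. The unit axiom of the ring together with
  the multiplication rules forces \<open>1 = I 1 + \<dots> + I m\<close> (lemma \<open>one_eq\<close>).
\<close>

locale cartan_algebra = vector_space cscale
  for cscale :: "complex \<Rightarrow> 'a::{comm_ring_1, real_normed_vector} \<Rightarrow> 'a" (infixr "*\<^sub>C" 75) +
  fixes n m :: nat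
    and I :: "nat \<Rightarrow> 'a"
    and \<Upsilon> :: "nat \<Rightarrow> nat \<Rightarrow> nat \<Rightarrow> complex"
  assumes cscale_of_real: "complex_of_real x *\<^sub>C a = x *\<^sub>R a"
    and cscale_mult_left: "(c *\<^sub>C a) * b = c *\<^sub>C (a * b)"
    and m_bounds: "1 \<le> m" "m \<le> n"
    and basis_inj: "inj_on I {1..n}"
    and basis_independent: "independent (I ` {1..n})"
    and basis_span: "span (I ` {1..n}) = UNIV"
    and idempotents: "\<lbrakk>r \<in> {1..m}; s \<in> {1..m}\<rbrakk> \<Longrightarrow> I r * I s = (if r = s then I r else 0)"
    and nilpotents: "\<lbrakk>r \<in> {m+1..n}; s \<in> {m+1..n}\<rbrakk> \<Longrightarrow>
      I r * I s = (\<Sum>k = max r s + 1..n. \<Upsilon> r k s *\<^sub>C I k)"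
    and mixed: "s \<in> {m+1..n} \<Longrightarrow>
      \<exists>!u. u \<in> {1..m} \<and> (\<forall>r\<in>{1..m}. I r * I s = (if r = u then I s else 0))"
    and norm_eq: "norm (\<Sum>j = 1..n. v j *\<^sub>C I j) = sqrt (\<Sum>j = 1..n. (cmod (v j))\<^sup>2)"
begin

definition functional :: "nat \<Rightarrow> 'a \<Rightarrow> complex" where
  "functional u = (THE f. Vector_Spaces.linear cscale (*) f \<and>
     (\<forall>r\<in>{1..n}. f (I r) = (if r = u then 1 else 0)))"

lemma functional_ex1:
  "\<exists>!f. Vector_Spaces.linear cscale (*) f \<and> (\<forall>r\<in>{1..n}. f (I r) = (if r = u then 1 else 0))"
proof -
  interpret C: vector_space "(*) :: complex \<Rightarrow> complex \<Rightarrow> complex"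
    by unfold_locales (simp_all add: distrib_left distrib_right mult.assoc)
  interpret VP: vector_space_pair cscale "(*) :: complex \<Rightarrow> complex \<Rightarrow> complex" ..
  define g :: "'a \<Rightarrow> complex" where
    "g b = (if the_inv_into {1..n} I b = u then 1 else 0)" for b
  obtain f where f: "Vector_Spaces.linear cscale (*) f" "\<forall>b\<in>I ` {1..n}. f b = g b"
    using VP.linear_independent_extend[OF basis_independent, of g] by blast
  have fI: "\<forall>r\<in>{1..n}. f (I r) = (if r = u then 1 else 0)"
    using f(2) the_inv_into_f_f[OF basis_inj] unfolding g_def by (metis imageI)
  show ?thesis
  proof (rule ex1I)
    show "Vector_Spaces.linear cscale (*) f \<and> (\<forall>r\<in>{1..n}. f (I r) = (if r = u then 1 else 0))"
      using f(1) fI by blast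
    fix h
    assume h: "Vector_Spaces.linear cscale (*) h \<and>
      (\<forall>r\<in>{1..n}. h (I r) = (if r = u then 1 else 0))"
    show "h = f"
    proof
      fix x
      have x: "x \<in> span (I ` {1..n})" unfolding basis_span by (rule UNIV_I)
      have eq: "h b = f b" if b: "b \<in> I ` {1..n}" for b
      proof -
        from b obtain r where "r \<in> {1..n}" "b = I r" by blast
        then show ?thesis using h fI by metis
      qed
      show "h x = f x"
        by (rule VP.linear_eq_on[OF conjunct1[OF h] f(1) x eq])
    qed
  qed
qed

lemma functional_linear: "Vector_Spaces.linear cscale (*) (functional u)"
  and functional_basis: "r \<in> {1..n} \<Longrightarrow> functional u (I r) = (if r = u then 1 else 0)"
  using theI'[OF functional_ex1[of u]] unfolding functional_def by blast+

lemma one_eq: "1 = (\<Sum>r = 1..m. I r)"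
proof -
  let ?e = "\<Sum>r = 1..m. I r"
  have basis: "b * ?e = b" if "b \<in> I ` {1..n}" for b
  proof -
    from that obtain s where s: "s \<in> {1..n}" "b = I s" by blast
    show ?thesis
    proof (cases "s \<le> m")
      case True
      have "I s * ?e = (\<Sum>r = 1..m. if s = r then I s else 0)"
        unfolding sum_distrib_left
      proof (rule sum.cong[OF refl])
        fix r assume "r \<in> {1..m}"
        then show "I s * I r = (if s = r then I s else 0)"
          using s True by (intro idempotents) simp_all
      qed
      then show ?thesis using s True by simp
    next
      case False
      then have "s \<in> {m+1..n}" using s by auto
      from ex1_implies_ex[OF mixed[OF this]] obtain u where
        u: "u \<in> {1..m}" "\<forall>r\<in>{1..m}. I r * I s = (if r = u then I s else 0)" by blast
      have "I s * ?e = (\<Sum>r = 1..m. if r = u then I s else 0)"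
        unfolding sum_distrib_left
      proof (rule sum.cong[OF refl])
        fix r assume "r \<in> {1..m}"
        then show "I s * I r = (if r = u then I s else 0)"
          using u(2) mult.commute[of "I s" "I r"] by simp
      qed
      then show ?thesis using u s by simp
    qed
  qed
  have "1 \<in> span (I ` {1..n})" using basis_span by simp
  then have "1 * ?e = 1"
  proof (induction rule: span_induct_alt)
    case base
    show ?case by simp
  next
    case (step c x y)
    then show ?case using basis[OF step(1)] by (simp only: distrib_right cscale_mult_left)
  qed
  then show ?thesis by simp
qed

end

definition real_hull :: "nat \<Rightarrow> (nat \<Rightarrow> 'a::real_vector) \<Rightarrow> 'a set" where
  "real_hull k e = {\<Sum>j = 1..k. x j *\<^sub>R e j | x :: nat \<Rightarrow> real. True}"

definition domain_in :: "'a::topological_space set \<Rightarrow> 'a set \<Rightarrow> bool" where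
  "domain_in E \<Omega> \<longleftrightarrow> \<Omega> \<noteq> {} \<and> openin (top_of_set E) \<Omega> \<and> connected \<Omega>"

definition locally_bounded_on :: "'a::topological_space set \<Rightarrow> ('a \<Rightarrow> 'b::metric_space) \<Rightarrow> bool" where
  "locally_bounded_on \<Omega> \<Phi> \<longleftrightarrow>
     (\<forall>\<zeta>\<in>\<Omega>. \<exists>U. openin (top_of_set \<Omega>) U \<and> \<zeta> \<in> U \<and> bounded (\<Phi> ` U))"

text \<open>
  A function on \<open>\<Omega>\<close> is represented by a total function. If \<open>\<Omega>\<close> is open in \<open>E\<close>, then
  \<open>\<zeta> + \<delta> *\<^sub>R h\<close> lies in \<open>\<Omega>\<close> for all small \<open>\<delta> > 0\<close>, so the one-sided
  limit below depends only on the values on \<open>\<Omega>\<close>.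
\<close>

definition gateaux_differentiable_at ::
    "'a::{comm_ring_1, real_normed_vector} set \<Rightarrow> ('a \<Rightarrow> 'a) \<Rightarrow> 'a \<Rightarrow> bool" where
  "gateaux_differentiable_at E \<Phi> \<zeta> \<longleftrightarrow>
     (\<exists>D. \<forall>h\<in>E. ((\<lambda>\<delta>. (\<Phi> (\<zeta> + \<delta> *\<^sub>R h) - \<Phi> \<zeta>) /\<^sub>R \<delta>) \<longlongrightarrow> h * D) (at_right 0))"

definition gateaux_differentiable_on ::
    "'a::{comm_ring_1, real_normed_vector} set \<Rightarrow> 'a set \<Rightarrow> ('a \<Rightarrow> 'a) \<Rightarrow> bool" where
  "gateaux_differentiable_on E \<Omega> \<Phi> \<longleftrightarrow> (\<forall>\<zeta>\<in>\<Omega>. gateaux_differentiable_at E \<Phi> \<zeta>)"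

definition monogenic_on ::
    "'a::{comm_ring_1, real_normed_vector} set \<Rightarrow> 'a set \<Rightarrow> ('a \<Rightarrow> 'a) \<Rightarrow> bool" where
  "monogenic_on E \<Omega> \<Phi> \<longleftrightarrow> continuous_on \<Omega> \<Phi> \<and> gateaux_differentiable_on E \<Omega> \<Phi>"

definition lorch_differentiable_at ::
    "'a::{comm_ring_1, real_normed_vector} set \<Rightarrow> 'a set \<Rightarrow> ('a \<Rightarrow> 'a) \<Rightarrow> 'a \<Rightarrow> bool" where
  "lorch_differentiable_at E \<Omega> \<Phi> \<zeta> \<longleftrightarrow>
     (\<exists>D. \<forall>\<epsilon>>0. \<exists>\<delta>>0. \<forall>h\<in>E. norm h < \<delta> \<and> \<zeta> + h \<in> \<Omega> \<longrightarrow>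
        norm (\<Phi> (\<zeta> + h) - \<Phi> \<zeta> - h * D) \<le> norm h * \<epsilon>)"

definition lorch_differentiable_on ::
    "'a::{comm_ring_1, real_normed_vector} set \<Rightarrow> 'a set \<Rightarrow> ('a \<Rightarrow> 'a) \<Rightarrow> bool" where
  "lorch_differentiable_on E \<Omega> \<Phi> \<longleftrightarrow> (\<forall>\<zeta>\<in>\<Omega>. lorch_differentiable_at E \<Omega> \<Phi> \<zeta>)"

end

theory Submission
  imports Defs "HOL-Complex_Analysis.Cauchy_Integral_Formula"
begin

text \<open>
  A Lorch differentiable function is continuous and Gateaux differentiable, and a continuous
  function is locally bounded; the content of the theorem is that a locally bounded Gateaux
  differentiable \<open>\<Phi>\<close> is Lorch differentiable. Continuity of \<open>\<Phi>\<close> is not available at the start: only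
  the restrictions of \<open>\<Phi>\<close> to lines are known to be continuous. Two ideas, one from the theory of
  functions of one complex variable and one from algebra, lead to the result.

  \<^emph>\<open>The plane.\<close> A bounded function on a square which has partial derivatives everywhere, with
  \<open>f\<^sub>y = \<i> f\<^sub>x\<close>, is holomorphic (\<open>bounded_cauchy_riemann_imp_holomorphic\<close>, a theorem of the
  Looman-Menchoff-Tolstov type). Being continuous on horizontal and vertical segments, \<open>f\<close> can be
  integrated over the boundary of a rectangle, and everything rests on the fact that these integrals
  vanish. Fix \<open>\<epsilon> > 0\<close> and call a point tame if the integral over every rectangle near it is at
  most \<open>\<epsilon>\<close> times the area. If some point were not tame, the Baire category theorem would
  give a piece of the closed set of these points on which the difference quotients of \<open>f\<close> in the two
  axis directions are, at a common scale, within \<open>\<epsilon> / 14\<close> of constants \<open>q\<close> and \<open>\<i> q\<close>. Cut a small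
  rectangle which meets this piece down to the bounding box of the intersection. All four sides of the
  box contain points of the piece, so the integral over the box is small; the remaining strips contain
  only tame points in their interiors. The measure of the piece controls the sum of these contributions over a
  subdivision, and the bound \<open>\<epsilon>\<close> times the area results for all rectangles near the piece, so that
  its points are tame after all. Since the integrals vanish, \<open>f\<close> has a primitive \<open>F\<close>. It is
  Lipschitz and satisfies the same hypotheses, hence has itself a primitive, which is complex
  differentiable because \<open>F\<close> is jointly continuous. So \<open>F\<close> and \<open>f = F'\<close> are holomorphic.

  \<^emph>\<open>The algebra.\<close> Multiplication is triangular in the Cartan basis: \<open>x I\<^sub>s\<close> equals \<open>f\<^sub>u(x) I\<^sub>s\<close>, where
  \<open>u = u\<^sub>s\<close>, up to basis elements after \<open>I\<^sub>s\<close>. If the coordinates of \<open>\<Phi>\<close> before the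
  one at \<open>s\<close> vanish, this one therefore has the directional derivatives \<open>f\<^sub>u(h) c\<close>. It is locally
  constant on the fibres of \<open>f\<^sub>u\<close>, and because \<open>f\<^sub>u\<close> maps \<open>E\<close> onto \<open>\<complex>\<close> there is a
  plane in \<open>E\<close> transversal to the fibres, on which the theorem on plane functions applies. So the
  coordinate is \<open>F \<circ> f\<^sub>u\<close> with \<open>F\<close> holomorphic (\<open>factor_through_functional\<close>). The Taylor expansion of
  \<open>F\<close> at \<open>f\<^sub>u(x)\<close>, evaluated at the element \<open>x I\<^sub>u\<close> which differs from \<open>f\<^sub>u(x) I\<^sub>u\<close> by a
  nilpotent, terminates; multiplied by \<open>I\<^sub>s\<close> it is a function with the same coordinate at \<open>s\<close> and with
  a Frechet derivative of the form \<open>h \<mapsto> h D\<close> (\<open>has_derivative_taylor_lift\<close>). Subtracting it leaves a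
  function of the same kind whose coordinates up to \<open>s\<close> vanish. After \<open>n\<close> such steps \<open>\<Phi>\<close> is exhibited
  locally as a sum of Frechet differentiable functions (\<open>gateaux_imp_has_derivative_flag\<close>).
\<close>

section \<open>Boundary integrals over rectangles\<close>

text \<open>
  Goursat's nested rectangles as an induction rule: if the property failed for a rectangle, it would
  fail for a sequence of nested quarters shrinking to a point. Quarters keep the ratio of the sides,
  which matters when the property only concerns rectangles that are not too thin.
\<close>

lemma quadrisection_induct:
  fixes P :: "real \<Rightarrow> real \<Rightarrow> real \<Rightarrow> real \<Rightarrow> bool"
  assumes "x1 \<le> x2" "y1 \<le> y2"
    and quarters: "\<And>a b c d. \<lbrakk>a \<le> b; c \<le> d; P a ((a + b) / 2) c ((c + d) / 2); P ((a + b) / 2) b c ((c + d) / 2);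
        P a ((a + b) / 2) ((c + d) / 2) d; P ((a + b) / 2) b ((c + d) / 2) d\<rbrakk> \<Longrightarrow> P a b c d"
    and small: "\<And>x y. \<lbrakk>x1 \<le> x; x \<le> x2; y1 \<le> y; y \<le> y2\<rbrakk> \<Longrightarrow>
        \<exists>\<delta>>0. \<forall>a b c d. a \<le> x \<and> x \<le> b \<and> c \<le> y \<and> y \<le> d \<and> b - a < \<delta> \<and> d - c < \<delta> \<longrightarrow> P a b c d"
  shows "P x1 x2 y1 y2"
proof (rule ccontr)
  assume neg: "\<not> P x1 x2 y1 y2"
  define R where "R = (\<lambda>k. \<lambda>(a, b, c, d). a \<le> b \<and> c \<le> d \<and> b - a = (x2 - x1) / 2 ^ k
      \<and> d - c = (y2 - y1) / 2 ^ k \<and> (k = 0 \<longrightarrow> a = x1 \<and> b = x2 \<and> c = y1 \<and> d = y2) \<and> \<not> P a b c d)"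
  define S where "S = (\<lambda>(k::nat). \<lambda>(a, b, c, d). \<lambda>(a', b', c', d').
      a \<le> (a' :: real) \<and> b' \<le> (b :: real) \<and> c \<le> (c' :: real) \<and> d' \<le> (d :: real))"
  have "\<exists>q. \<forall>k. R k (q k) \<and> S k (q k) (q (Suc k))"
  proof (rule dependent_nat_choice)
    show "\<exists>q. R 0 q" using neg assms(1,2) by (auto simp: R_def)
  next
    fix q k assume q: "R k q"
    obtain a b c d where q_eq: "q = (a, b, c, d)" by (cases q) auto
    have h: "a \<le> b" "c \<le> d" "b - a = (x2 - x1) / 2 ^ k" "d - c = (y2 - y1) / 2 ^ k" "\<not> P a b c d"
      using q unfolding R_def q_eq by auto
    define s t where "s = (a + b) / 2" and "t = (c + d) / 2"
    have st: "a \<le> s" "s \<le> b" "c \<le> t" "t \<le> d"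
      using h(1,2) by (auto simp: s_def t_def)
    have half: "s - a = (x2 - x1) / 2 ^ Suc k" "b - s = (x2 - x1) / 2 ^ Suc k"
      "t - c = (y2 - y1) / 2 ^ Suc k" "d - t = (y2 - y1) / 2 ^ Suc k"
      using h(3,4) by (auto simp: s_def t_def field_simps)
    have "\<not> (P a s c t \<and> P s b c t \<and> P a s t d \<and> P s b t d)"
      using quarters[OF h(1,2)] h(5) unfolding s_def t_def by blast
    then consider "\<not> P a s c t" | "\<not> P s b c t" | "\<not> P a s t d" | "\<not> P s b t d" by blast
    then show "\<exists>q'. R (Suc k) q' \<and> S k q q'"
    proof cases
      case 1 then show ?thesis using st half by (intro exI[of _ "(a, s, c, t)"]) (auto simp: R_def S_def q_eq)
    next
      case 2 then show ?thesis using st half by (intro exI[of _ "(s, b, c, t)"]) (auto simp: R_def S_def q_eq)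
    next
      case 3 then show ?thesis using st half by (intro exI[of _ "(a, s, t, d)"]) (auto simp: R_def S_def q_eq)
    next
      case 4 then show ?thesis using st half by (intro exI[of _ "(s, b, t, d)"]) (auto simp: R_def S_def q_eq)
    qed
  qed
  then obtain q where q: "\<And>k. R k (q k)" "\<And>k. S k (q k) (q (Suc k))" by blast
  define A B C D where "A = (\<lambda>k. fst (q k))" and "B = (\<lambda>k. fst (snd (q k)))"
    and "C = (\<lambda>k. fst (snd (snd (q k))))" and "D = (\<lambda>k. snd (snd (snd (q k))))"
  have R: "A k \<le> B k" "C k \<le> D k" "B k - A k = (x2 - x1) / 2 ^ k" "D k - C k = (y2 - y1) / 2 ^ k"
      "\<not> P (A k) (B k) (C k) (D k)" for k
    using q(1)[of k] unfolding R_def A_def B_def C_def D_def by (auto split: prod.splits)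
  have R0: "A 0 = x1" "B 0 = x2" "C 0 = y1" "D 0 = y2"
    using q(1)[of 0] unfolding R_def A_def B_def C_def D_def by (auto split: prod.splits)
  have S: "A k \<le> A (Suc k)" "B (Suc k) \<le> B k" "C k \<le> C (Suc k)" "D (Suc k) \<le> D k" for k
    using q(2)[of k] unfolding S_def A_def B_def C_def D_def by (auto split: prod.splits)
  have lim: "(\<lambda>k. r / 2 ^ k) \<longlonglongrightarrow> 0" for r :: real
    using tendsto_mult[OF tendsto_const[of r] LIMSEQ_realpow_zero[of "1/2"]]
    by (simp add: power_divide)
  have wA: "(\<lambda>k. A k - B k) \<longlonglongrightarrow> 0" and wC: "(\<lambda>k. C k - D k) \<longlonglongrightarrow> 0"
  proof -
    have "A k - B k = (x1 - x2) / 2 ^ k" "C k - D k = (y1 - y2) / 2 ^ k" for k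
      using R(3,4)[of k] by (auto simp: field_simps)
    then show "(\<lambda>k. A k - B k) \<longlonglongrightarrow> 0" "(\<lambda>k. C k - D k) \<longlonglongrightarrow> 0"
      using lim by simp_all
  qed
  obtain x where x: "\<And>k. A k \<le> x" "\<And>k. x \<le> B k"
    using nested_sequence_unique[of A B] S R wA by blast
  obtain y where y: "\<And>k. C k \<le> y" "\<And>k. y \<le> D k"
    using nested_sequence_unique[of C D] S R wC by blast
  obtain \<delta> where \<delta>: "\<delta> > 0"
    "\<And>a b c d. a \<le> x \<Longrightarrow> x \<le> b \<Longrightarrow> c \<le> y \<Longrightarrow> y \<le> d \<Longrightarrow> b - a < \<delta> \<Longrightarrow> d - c < \<delta> \<Longrightarrow> P a b c d"
    using small[of x y] x[of 0] y[of 0] R0 by auto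
  have "\<forall>\<^sub>F k in sequentially. (x2 - x1) / 2 ^ k < \<delta> \<and> (y2 - y1) / 2 ^ k < \<delta>"
    using order_tendstoD(2)[OF lim \<delta>(1)] by (auto intro: eventually_conj)
  then obtain k where "(x2 - x1) / 2 ^ k < \<delta>" "(y2 - y1) / 2 ^ k < \<delta>"
    by (auto simp: eventually_sequentially)
  then have "P (A k) (B k) (C k) (D k)"
    using \<delta>(2) x y R(3,4) by simp
  with R(5) show False by blast
qed

text \<open>
  Functions that are merely separately continuous have no uniformly convergent restrictions to
  neighbouring lines; boundedness and dominated convergence replace uniformity.
\<close>

lemma integral_tendsto_moving_endpoints:
  fixes f :: "nat \<Rightarrow> real \<Rightarrow> complex"
  assumes cont: "\<And>k. continuous_on {a..b} (f k)"
    and bd: "\<And>k x. x \<in> {a..b} \<Longrightarrow> norm (f k x) \<le> B"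
    and lim: "\<And>x. x \<in> {a..b} \<Longrightarrow> (\<lambda>k. f k x) \<longlonglongrightarrow> g x"
    and ends: "\<And>k. a \<le> u k" "\<And>k. u k \<le> v k" "\<And>k. v k \<le> b" "u \<longlonglongrightarrow> a" "v \<longlonglongrightarrow> b"
  shows "(\<lambda>k. integral {u k..v k} (f k)) \<longlonglongrightarrow> integral {a..b} g"
proof -
  have le: "a \<le> b" using ends(1-3)[of 0] by linarith
  have int: "f k integrable_on {c..d}" if "a \<le> c" "d \<le> b" for k c d
    using that by (intro integrable_continuous_real continuous_on_subset[OF cont]) auto
  have B: "0 \<le> B" using bd[of a 0] le norm_ge_zero[of "f 0 a"] by (simp del: norm_ge_zero)
  have main: "(\<lambda>k. integral {a..b} (f k)) \<longlonglongrightarrow> integral {a..b} g"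
    by (rule dominated_convergence(2)[where h = "\<lambda>_. B"]) (use int bd lim in auto)
  have est: "norm (integral {c..d} (f k)) \<le> B * (d - c)" if "a \<le> c" "c \<le> d" "d \<le> b" for c d k
    by (rule integral_bound) (use that bd in \<open>auto intro: continuous_on_subset[OF cont]\<close>)
  have "norm (integral {u k..v k} (f k) - integral {a..b} (f k)) \<le> B * (u k - a) + B * (b - v k)" for k
  proof -
    have "integral {a..b} (f k) = integral {a..u k} (f k) + integral {u k..b} (f k)"
      using ends(1-3)[of k] by (intro Henstock_Kurzweil_Integration.integral_combine[symmetric] int) auto
    also have "integral {u k..b} (f k) = integral {u k..v k} (f k) + integral {v k..b} (f k)"
      using ends(1-3)[of k] by (intro Henstock_Kurzweil_Integration.integral_combine[symmetric] int) auto
    finally have "integral {u k..v k} (f k) - integral {a..b} (f k)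
        = - (integral {a..u k} (f k) + integral {v k..b} (f k))" by simp
    also have "norm \<dots> \<le> norm (integral {a..u k} (f k)) + norm (integral {v k..b} (f k))"
      unfolding norm_minus_cancel by (rule norm_triangle_ineq)
    also have "\<dots> \<le> B * (u k - a) + B * (b - v k)"
      using ends(1-3)[of k] by (intro add_mono est) auto
    finally show ?thesis .
  qed
  moreover have "(\<lambda>k. B * (u k - a) + B * (b - v k)) \<longlonglongrightarrow> 0"
  proof -
    have "(\<lambda>k. B * (u k - a) + B * (b - v k)) \<longlonglongrightarrow> B * (a - a) + B * (b - b)"
      by (intro tendsto_intros ends)
    then show ?thesis by simp
  qed
  ultimately have "(\<lambda>k. integral {u k..v k} (f k) - integral {a..b} (f k)) \<longlonglongrightarrow> 0"
    by (rule_tac Lim_null_comparison) auto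
  from tendsto_add[OF this main] show ?thesis by simp
qed

text \<open>The contour integral of \<open>f\<close> over the positively oriented boundary of a rectangle.\<close>

definition rect_integral :: "(real \<Rightarrow> real \<Rightarrow> complex) \<Rightarrow> real \<Rightarrow> real \<Rightarrow> real \<Rightarrow> real \<Rightarrow> complex" where
  "rect_integral f x1 x2 y1 y2 =
     integral {x1..x2} (\<lambda>x. f x y1 - f x y2) + \<i> * integral {y1..y2} (\<lambda>y. f x2 y - f x1 y)"

text \<open>
  The Cauchy-Riemann equation \<open>f\<^sub>y = \<i> f\<^sub>x\<close> at every point of an open square, for a bounded function
  whose partial derivatives may be unbounded.
\<close>

locale cauchy_riemann_square =
  fixes f d :: "real \<Rightarrow> real \<Rightarrow> complex" and s M :: real
  assumes deriv_x: "\<lbrakk>\<bar>x\<bar> < s; \<bar>y\<bar> < s\<rbrakk> \<Longrightarrow> ((\<lambda>t. f t y) has_vector_derivative d x y) (at x)"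
    and deriv_y: "\<lbrakk>\<bar>x\<bar> < s; \<bar>y\<bar> < s\<rbrakk> \<Longrightarrow> ((\<lambda>t. f x t) has_vector_derivative \<i> * d x y) (at y)"
    and bounded: "\<lbrakk>\<bar>x\<bar> < s; \<bar>y\<bar> < s\<rbrakk> \<Longrightarrow> norm (f x y) \<le> M"
begin

definition square :: "(real \<times> real) set" where
  "square = {(x, y). \<bar>x\<bar> < s \<and> \<bar>y\<bar> < s}"

lemma open_square: "open square"
proof -
  have "square = {-s<..<s} \<times> {-s<..<s}" by (auto simp: square_def)
  then show ?thesis by (simp add: open_Times)
qed

lemma cont_x: "\<bar>x\<bar> < s \<Longrightarrow> \<bar>y\<bar> < s \<Longrightarrow> isCont (\<lambda>t. f t y) x"
  using deriv_x has_vector_derivative_continuous by blast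

lemma cont_y: "\<bar>x\<bar> < s \<Longrightarrow> \<bar>y\<bar> < s \<Longrightarrow> isCont (\<lambda>t. f x t) y"
  using deriv_y has_vector_derivative_continuous by blast

lemma cont_on_x: "\<lbrakk>-s < a; b < s; \<bar>y\<bar> < s\<rbrakk> \<Longrightarrow> continuous_on {a..b} (\<lambda>x. f x y)"
  by (intro continuous_at_imp_continuous_on ballI cont_x) auto

lemma cont_on_y: "\<lbrakk>-s < a; b < s; \<bar>x\<bar> < s\<rbrakk> \<Longrightarrow> continuous_on {a..b} (\<lambda>y. f x y)"
  by (intro continuous_at_imp_continuous_on ballI cont_y) auto

lemma rect_integral_split_x:
  assumes "-s < a" "a \<le> b" "b \<le> c" "c < s" "-s < y1" "y1 \<le> y2" "y2 < s"
  shows "rect_integral f a c y1 y2 = rect_integral f a b y1 y2 + rect_integral f b c y1 y2"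
proof -
  have ix: "(\<lambda>x. f x y1 - f x y2) integrable_on {u..v}" if "-s < u" "v < s" for u v
    using assms that by (intro integrable_continuous_real continuous_intros cont_on_x) auto
  have iy: "(\<lambda>y. f u y - f v y) integrable_on {y1..y2}" if "\<bar>u\<bar> < s" "\<bar>v\<bar> < s" for u v
    using assms that by (intro integrable_continuous_real continuous_intros cont_on_y) auto
  have "integral {a..c} (\<lambda>x. f x y1 - f x y2)
      = integral {a..b} (\<lambda>x. f x y1 - f x y2) + integral {b..c} (\<lambda>x. f x y1 - f x y2)"
    using assms by (intro Henstock_Kurzweil_Integration.integral_combine[symmetric] ix) auto
  moreover have "integral {y1..y2} (\<lambda>y. f c y - f a y)
      = integral {y1..y2} (\<lambda>y. f b y - f a y) + integral {y1..y2} (\<lambda>y. f c y - f b y)"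
  proof -
    have "integral {y1..y2} (\<lambda>y. f b y - f a y) + integral {y1..y2} (\<lambda>y. f c y - f b y)
      = integral {y1..y2} (\<lambda>y. (f b y - f a y) + (f c y - f b y))"
      using assms by (intro Henstock_Kurzweil_Integration.integral_add[symmetric] iy) auto
    then show ?thesis by simp
  qed
  ultimately show ?thesis by (simp add: rect_integral_def distrib_left)
qed

lemma rect_integral_split_y:
  assumes "-s < a" "a \<le> b" "b \<le> c" "c < s" "-s < x1" "x1 \<le> x2" "x2 < s"
  shows "rect_integral f x1 x2 a c = rect_integral f x1 x2 a b + rect_integral f x1 x2 b c"
proof -
  have iy: "(\<lambda>y. f x2 y - f x1 y) integrable_on {u..v}" if "-s < u" "v < s" for u v
    using assms that by (intro integrable_continuous_real continuous_intros cont_on_y) auto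
  have ix: "(\<lambda>x. f x u - f x v) integrable_on {x1..x2}" if "\<bar>u\<bar> < s" "\<bar>v\<bar> < s" for u v
    using assms that by (intro integrable_continuous_real continuous_intros cont_on_x) auto
  have "integral {a..c} (\<lambda>y. f x2 y - f x1 y)
      = integral {a..b} (\<lambda>y. f x2 y - f x1 y) + integral {b..c} (\<lambda>y. f x2 y - f x1 y)"
    using assms by (intro Henstock_Kurzweil_Integration.integral_combine[symmetric] iy) auto
  moreover have "integral {x1..x2} (\<lambda>x. f x a - f x c)
      = integral {x1..x2} (\<lambda>x. f x a - f x b) + integral {x1..x2} (\<lambda>x. f x b - f x c)"
  proof -
    have "integral {x1..x2} (\<lambda>x. f x a - f x b) + integral {x1..x2} (\<lambda>x. f x b - f x c)
      = integral {x1..x2} (\<lambda>x. (f x a - f x b) + (f x b - f x c))"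
      using assms by (intro Henstock_Kurzweil_Integration.integral_add[symmetric] ix) auto
    then show ?thesis by simp
  qed
  ultimately show ?thesis by (simp add: rect_integral_def distrib_left)
qed

lemma rect_integral_quarters:
  assumes "-s < a" "a \<le> b" "b \<le> c" "c < s" "-s < u" "u \<le> v" "v \<le> w" "w < s"
  shows "rect_integral f a c u w = rect_integral f a b u v + rect_integral f b c u v
      + rect_integral f a b v w + rect_integral f b c v w"
  using rect_integral_split_x[of a b c u w] rect_integral_split_y[of u v w a b]
    rect_integral_split_y[of u v w b c] assms by auto

text \<open>
  The radius \<open>r\<close> is bounded in terms of the distance to the boundary so that all the rectangles lie
  in the square, where boundary integrals are additive.
\<close>

definition tame :: "real \<Rightarrow> (real \<times> real) set" where
  "tame \<epsilon> = {(x, y). \<exists>r>0. \<bar>x\<bar> + r \<le> s \<and> \<bar>y\<bar> + r \<le> s \<and> (\<forall>a b c d. x - r < a \<and> a \<le> b \<and> b < x + r \<and>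
      y - r < c \<and> c \<le> d \<and> d < y + r \<longrightarrow> norm (rect_integral f a b c d) \<le> \<epsilon> * ((b - a) * (d - c)))}"

lemma tame_subset: "tame \<epsilon> \<subseteq> square"
  by (auto simp: tame_def square_def)

lemma tameD:
  assumes "(x, y) \<in> tame \<epsilon>"
  obtains r where "r > 0" "{x - r<..<x + r} \<times> {y - r<..<y + r} \<subseteq> tame \<epsilon>"
    "\<And>a b c d. \<lbrakk>x - r < a; a \<le> b; b < x + r; y - r < c; c \<le> d; d < y + r\<rbrakk> \<Longrightarrow>
       norm (rect_integral f a b c d) \<le> \<epsilon> * ((b - a) * (d - c))"
proof -
  obtain r where r: "r > 0" "\<bar>x\<bar> + r \<le> s" "\<bar>y\<bar> + r \<le> s"
    "\<And>a b c d. \<lbrakk>x - r < a; a \<le> b; b < x + r; y - r < c; c \<le> d; d < y + r\<rbrakk> \<Longrightarrow>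
       norm (rect_integral f a b c d) \<le> \<epsilon> * ((b - a) * (d - c))"
    using assms unfolding tame_def by blast
  have "(u, v) \<in> tame \<epsilon>" if "x - r < u" "u < x + r" "y - r < v" "v < y + r" for u v
  proof -
    define t where "t = min (min (u - (x - r)) (x + r - u)) (min (v - (y - r)) (y + r - v))"
    have t: "t > 0" "t \<le> u - (x - r)" "t \<le> x + r - u" "t \<le> v - (y - r)" "t \<le> y + r - v"
      using that by (auto simp: t_def)
    show ?thesis unfolding tame_def
      using t r(2,3) by (auto intro!: exI[of _ t] r(4))
  qed
  then show ?thesis using r by (intro that[of r]) auto
qed

lemma open_tame: "open (tame \<epsilon>)"
proof (subst open_subopen, intro ballI)
  fix p assume "p \<in> tame \<epsilon>"
  moreover obtain x y where "p = (x, y)" by (cases p)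
  ultimately obtain r where "r > 0" "{x - r<..<x + r} \<times> {y - r<..<y + r} \<subseteq> tame \<epsilon>" "p = (x, y)"
    by (auto elim: tameD)
  then show "\<exists>T. open T \<and> p \<in> T \<and> T \<subseteq> tame \<epsilon>"
    by (intro exI[of _ "{x - r<..<x + r} \<times> {y - r<..<y + r}"]) (auto simp: open_Times)
qed

lemma rect_integral_le_closed:
  assumes "x1 \<le> x2" "y1 \<le> y2" and sub: "{x1..x2} \<times> {y1..y2} \<subseteq> tame \<epsilon>"
  shows "norm (rect_integral f x1 x2 y1 y2) \<le> \<epsilon> * ((x2 - x1) * (y2 - y1))"
proof -
  define P where "P a b c d \<longleftrightarrow> (x1 \<le> a \<and> a \<le> b \<and> b \<le> x2 \<and> y1 \<le> c \<and> c \<le> d \<and> d \<le> y2 \<longrightarrow>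
      norm (rect_integral f a b c d) \<le> \<epsilon> * ((b - a) * (d - c)))" for a b c d
  have corner: "(x1, y1) \<in> square" "(x2, y2) \<in> square"
    using assms(1,2) subsetD[OF sub, of "(x1, y1)"] subsetD[OF sub, of "(x2, y2)"] tame_subset[of \<epsilon>] by auto
  have "P x1 x2 y1 y2"
  proof (rule quadrisection_induct[OF assms(1,2)])
    fix a b c d :: real
    define u v where "u = (a + b) / 2" and "v = (c + d) / 2"
    assume le: "a \<le> b" "c \<le> d"
    assume quarters: "P a ((a + b) / 2) c ((c + d) / 2)" "P ((a + b) / 2) b c ((c + d) / 2)"
      "P a ((a + b) / 2) ((c + d) / 2) d" "P ((a + b) / 2) b ((c + d) / 2) d"
    note quarters = quarters[folded u_def v_def]
    have uv: "a \<le> u" "u \<le> b" "c \<le> v" "v \<le> d" using le by (auto simp: u_def v_def)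
    show "P a b c d" unfolding P_def
    proof
      assume R: "x1 \<le> a \<and> a \<le> b \<and> b \<le> x2 \<and> y1 \<le> c \<and> c \<le> d \<and> d \<le> y2"
      have "rect_integral f a b c d = rect_integral f a u c v + rect_integral f u b c v
          + rect_integral f a u v d + rect_integral f u b v d"
        using R uv corner by (intro rect_integral_quarters) (auto simp: square_def)
      also have "norm \<dots> \<le> norm (rect_integral f a u c v) + norm (rect_integral f u b c v)
          + norm (rect_integral f a u v d) + norm (rect_integral f u b v d)"
        by (meson norm_triangle_le order_refl add_mono)
      also have "\<dots> \<le> \<epsilon> * ((u - a) * (v - c)) + \<epsilon> * ((b - u) * (v - c))
          + \<epsilon> * ((u - a) * (d - v)) + \<epsilon> * ((b - u) * (d - v))"
        using quarters R uv unfolding P_def by (intro add_mono) auto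
      also have "\<dots> = \<epsilon> * ((b - a) * (d - c))" by (simp add: algebra_simps)
      finally show "norm (rect_integral f a b c d) \<le> \<epsilon> * ((b - a) * (d - c))" .
    qed
  next
    fix x y assume "x1 \<le> x" "x \<le> x2" "y1 \<le> y" "y \<le> y2"
    then have "(x, y) \<in> tame \<epsilon>" using sub by auto
    then obtain r where r: "r > 0"
      "\<And>a b c d. \<lbrakk>x - r < a; a \<le> b; b < x + r; y - r < c; c \<le> d; d < y + r\<rbrakk> \<Longrightarrow>
         norm (rect_integral f a b c d) \<le> \<epsilon> * ((b - a) * (d - c))"
      by (auto elim: tameD)
    show "\<exists>\<delta>>0. \<forall>a b c d. a \<le> x \<and> x \<le> b \<and> c \<le> y \<and> y \<le> d \<and> b - a < \<delta> \<and> d - c < \<delta> \<longrightarrow> P a b c d"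
      using r(1) unfolding P_def by (intro exI[of _ r]) (auto intro!: r(2))
  qed
  then show ?thesis using assms(1,2) by (simp add: P_def)
qed

lemma rect_integral_tendsto:
  assumes R: "-s < x1" "x1 \<le> x2" "x2 < s" "-s < y1" "y1 \<le> y2" "y2 < s"
    and in_R: "\<And>k. x1 \<le> a k" "\<And>k. a k \<le> b k" "\<And>k. b k \<le> x2" "\<And>k. y1 \<le> c k" "\<And>k. c k \<le> e k" "\<And>k. e k \<le> y2"
    and lim: "a \<longlonglongrightarrow> x1" "b \<longlonglongrightarrow> x2" "c \<longlonglongrightarrow> y1" "e \<longlonglongrightarrow> y2"
  shows "(\<lambda>k. rect_integral f (a k) (b k) (c k) (e k)) \<longlonglongrightarrow> rect_integral f x1 x2 y1 y2"
  unfolding rect_integral_def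
proof (intro tendsto_add tendsto_mult tendsto_const integral_tendsto_moving_endpoints lim in_R)
  have sq: "\<bar>a k\<bar> < s" "\<bar>b k\<bar> < s" "\<bar>c k\<bar> < s" "\<bar>e k\<bar> < s" for k
    using R in_R(1)[of k] in_R(2)[of k] in_R(3)[of k] in_R(4)[of k] in_R(5)[of k] in_R(6)[of k] by auto
  show "continuous_on {x1..x2} (\<lambda>x. f x (c k) - f x (e k))" for k
    using R sq by (intro continuous_intros cont_on_x) auto
  show "continuous_on {y1..y2} (\<lambda>y. f (b k) y - f (a k) y)" for k
    using R sq by (intro continuous_intros cont_on_y) auto
  show "norm (f x (c k) - f x (e k)) \<le> 2 * M" if "x \<in> {x1..x2}" for k x
  proof -
    have "\<bar>x\<bar> < s" using that R by auto
    then show ?thesis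
      using norm_triangle_ineq4[of "f x (c k)" "f x (e k)"] bounded[of x "c k"] bounded[of x "e k"] sq[of k]
      by linarith
  qed
  show "norm (f (b k) y - f (a k) y) \<le> 2 * M" if "y \<in> {y1..y2}" for k y
  proof -
    have "\<bar>y\<bar> < s" using that R by auto
    then show ?thesis
      using norm_triangle_ineq4[of "f (b k) y" "f (a k) y"] bounded[of "b k" y] bounded[of "a k" y] sq[of k]
      by linarith
  qed
  show "(\<lambda>k. f x (c k) - f x (e k)) \<longlonglongrightarrow> f x y1 - f x y2" if "x \<in> {x1..x2}" for x
  proof -
    have "\<bar>x\<bar> < s" "\<bar>y1\<bar> < s" "\<bar>y2\<bar> < s" using that R by auto
    then show ?thesis
      by (intro tendsto_diff isCont_tendsto_compose[of _ "\<lambda>y. f x y"] cont_y lim) auto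
  qed
  show "(\<lambda>k. f (b k) y - f (a k) y) \<longlonglongrightarrow> f x2 y - f x1 y" if "y \<in> {y1..y2}" for y
  proof -
    have "\<bar>y\<bar> < s" "\<bar>x1\<bar> < s" "\<bar>x2\<bar> < s" using that R by auto
    then show ?thesis
      by (intro tendsto_diff isCont_tendsto_compose[of _ "\<lambda>x. f x y"] cont_x lim) auto
  qed
qed

lemma rect_integral_degenerate:
  "rect_integral f x x y1 y2 = 0" "rect_integral f x1 x2 y y = 0"
  by (simp_all add: rect_integral_def)

text \<open>
  The integral over the rectangle is the limit of the integrals over slightly smaller ones, to which
  \<open>rect_integral_le_closed\<close> applies. In the main argument an edge of the rectangle does contain
  points that are not tame.
\<close>

lemma rect_integral_le_open:
  assumes R: "-s < x1" "x1 \<le> x2" "x2 < s" "-s < y1" "y1 \<le> y2" "y2 < s"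
    and sub: "{x1<..<x2} \<times> {y1<..<y2} \<subseteq> tame \<epsilon>"
  shows "norm (rect_integral f x1 x2 y1 y2) \<le> \<epsilon> * ((x2 - x1) * (y2 - y1))"
proof (cases "x1 = x2 \<or> y1 = y2")
  case True
  then show ?thesis by (auto simp: rect_integral_degenerate)
next
  case False
  with R have less: "x1 < x2" "y1 < y2" by auto
  define t where "t k = inverse (real (Suc (Suc k)))" for k
  have t: "0 < t k" "t k \<le> 1 / 2" for k
    unfolding t_def by (auto simp: field_simps)
  have t_lim: "t \<longlonglongrightarrow> 0"
    using LIMSEQ_Suc[OF LIMSEQ_inverse_real_of_nat] unfolding t_def by simp
  define a b c e where "a k = x1 + t k * (x2 - x1)" and "b k = x2 - t k * (x2 - x1)"
    and "c k = y1 + t k * (y2 - y1)" and "e k = y2 - t k * (y2 - y1)" for k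
  have tx: "0 < t k * (x2 - x1)" "t k * (x2 - x1) \<le> 1 / 2 * (x2 - x1)"
    and ty: "0 < t k * (y2 - y1)" "t k * (y2 - y1) \<le> 1 / 2 * (y2 - y1)" for k
    using less t[of k] by (auto intro!: mult_pos_pos mult_right_mono)
  have order: "x1 < a k" "a k \<le> b k" "b k < x2" "y1 < c k" "c k \<le> e k" "e k < y2" for k
    using tx[of k] ty[of k] unfolding a_def b_def c_def e_def by auto
  have lim: "a \<longlonglongrightarrow> x1" "b \<longlonglongrightarrow> x2" "c \<longlonglongrightarrow> y1" "e \<longlonglongrightarrow> y2"
  proof -
    have "a \<longlonglongrightarrow> x1 + 0 * (x2 - x1)" "b \<longlonglongrightarrow> x2 - 0 * (x2 - x1)"
      "c \<longlonglongrightarrow> y1 + 0 * (y2 - y1)" "e \<longlonglongrightarrow> y2 - 0 * (y2 - y1)"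
      unfolding a_def b_def c_def e_def by (intro tendsto_intros t_lim)+
    then show "a \<longlonglongrightarrow> x1" "b \<longlonglongrightarrow> x2" "c \<longlonglongrightarrow> y1" "e \<longlonglongrightarrow> y2" by simp_all
  qed
  have "norm (rect_integral f (a k) (b k) (c k) (e k)) \<le> \<epsilon> * ((b k - a k) * (e k - c k))" for k
  proof (rule rect_integral_le_closed)
    show "{a k..b k} \<times> {c k..e k} \<subseteq> tame \<epsilon>"
      using order[of k] by (intro order.trans[OF _ sub]) auto
  qed (use order in auto)
  moreover have "(\<lambda>k. rect_integral f (a k) (b k) (c k) (e k)) \<longlonglongrightarrow> rect_integral f x1 x2 y1 y2"
    using order by (intro rect_integral_tendsto R lim) (auto intro: less_imp_le)
  moreover have "(\<lambda>k. \<epsilon> * ((b k - a k) * (e k - c k))) \<longlonglongrightarrow> \<epsilon> * ((x2 - x1) * (y2 - y1))"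
    by (intro tendsto_intros lim)
  ultimately show ?thesis
    by (intro LIMSEQ_le[OF tendsto_norm]) auto
qed

end

section \<open>Uniform difference quotients and the Baire category argument\<close>

context cauchy_riemann_square
begin

text \<open>
  The points at which \<open>f\<close> agrees, up to slope \<open>\<eta>\<close>, with a complex linear function of derivative \<open>q\<close> on
  the two axis-parallel segments of half length \<open>r\<close>. Bounding the slope \<open>q\<close> uniformly would not be
  enough; fixing it allows the linear part, whose boundary integrals vanish, to be discarded.
\<close>

definition cross_set :: "real \<Rightarrow> real \<Rightarrow> complex \<Rightarrow> (real \<times> real) set" where
  "cross_set \<eta> r q = {(x, y) \<in> square. \<forall>h. \<bar>h\<bar> < r \<longrightarrow>
     (\<bar>x + h\<bar> < s \<longrightarrow> norm (f (x + h) y - f x y - q * h) \<le> \<eta> * \<bar>h\<bar>) \<and>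
     (\<bar>y + h\<bar> < s \<longrightarrow> norm (f x (y + h) - f x y - \<i> * q * h) \<le> \<eta> * \<bar>h\<bar>)}"

lemma cross_setD_x:
  assumes "(x, y) \<in> cross_set \<eta> r q" "\<bar>x' - x\<bar> < r" "\<bar>x'\<bar> < s"
  shows "norm (f x' y - f x y - q * (x' - x)) \<le> \<eta> * \<bar>x' - x\<bar>"
  using assms unfolding cross_set_def by (auto dest!: spec[of _ "x' - x"])

lemma cross_setD_y:
  assumes "(x, y) \<in> cross_set \<eta> r q" "\<bar>y' - y\<bar> < r" "\<bar>y'\<bar> < s"
  shows "norm (f x y' - f x y - \<i> * q * (y' - y)) \<le> \<eta> * \<bar>y' - y\<bar>"
  using assms unfolding cross_set_def by (auto dest!: spec[of _ "y' - y"])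

text \<open>
  Separate continuity is enough: if \<open>(x\<^sub>k, y\<^sub>k)\<close> tends to \<open>(x, y)\<close>, the horizontal segment
  through \<open>(x\<^sub>k, y\<^sub>k)\<close>, on which \<open>f\<close> is controlled, meets the vertical lines through \<open>(x, y)\<close> and
  \<open>(x + h, y)\<close>, and \<open>f\<close> is continuous along these two lines.
\<close>

lemma cross_set_closed:
  assumes p: "(x, y) \<in> square" "(x, y) \<in> closure (cross_set \<eta> r q)"
  shows "(x, y) \<in> cross_set \<eta> r q"
proof -
  obtain p where p: "\<And>k. p k \<in> cross_set \<eta> r q" "p \<longlonglongrightarrow> (x, y)"
    using p(2) closure_sequential by blast
  define X Y where "X k = fst (p k)" and "Y k = snd (p k)" for k :: nat
  have XY: "(X k, Y k) \<in> cross_set \<eta> r q" for k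
    using p(1) by (simp add: X_def Y_def)
  have lim: "X \<longlonglongrightarrow> x" "Y \<longlonglongrightarrow> y"
    using tendsto_fst[OF p(2)] tendsto_snd[OF p(2)] by (auto simp: X_def[abs_def] Y_def[abs_def])
  have sq: "\<bar>x\<bar> < s" "\<bar>y\<bar> < s" "\<bar>X k\<bar> < s" "\<bar>Y k\<bar> < s" for k
    using assms(1) XY[of k] by (auto simp: cross_set_def square_def)
  have hor: "norm (f (x + h) y - f x y - q * h) \<le> \<eta> * \<bar>h\<bar>" if h: "\<bar>h\<bar> < r" "\<bar>x + h\<bar> < s" for h
  proof (rule LIMSEQ_le)
    show "(\<lambda>k. norm (f (x + h) (Y k) - f x (Y k) - q * h)) \<longlonglongrightarrow> norm (f (x + h) y - f x y - q * h)"
      using h sq by (intro tendsto_intros isCont_tendsto_compose[of _ "\<lambda>y. f _ y"] cont_y lim) auto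
    show "(\<lambda>k. \<eta> * \<bar>x + h - X k\<bar> + \<eta> * \<bar>x - X k\<bar>) \<longlonglongrightarrow> \<eta> * \<bar>h\<bar>"
    proof -
      have "(\<lambda>k. \<eta> * \<bar>x + h - X k\<bar> + \<eta> * \<bar>x - X k\<bar>) \<longlonglongrightarrow> \<eta> * \<bar>x + h - x\<bar> + \<eta> * \<bar>x - x\<bar>"
        by (intro tendsto_intros lim)
      then show ?thesis by simp
    qed
    have "(\<lambda>k. \<bar>x + h - X k\<bar>) \<longlonglongrightarrow> \<bar>x + h - x\<bar>" "(\<lambda>k. \<bar>x - X k\<bar>) \<longlonglongrightarrow> \<bar>x - x\<bar>"
      by (intro tendsto_intros lim)+
    then have "\<forall>\<^sub>F k in sequentially. \<bar>x + h - X k\<bar> < r \<and> \<bar>x - X k\<bar> < r"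
      using h(1) by (intro eventually_conj) (auto elim!: order_tendstoD(2))
    then show "\<exists>N. \<forall>k\<ge>N. norm (f (x + h) (Y k) - f x (Y k) - q * h) \<le> \<eta> * \<bar>x + h - X k\<bar> + \<eta> * \<bar>x - X k\<bar>"
      unfolding eventually_sequentially
    proof (elim exE, intro exI allI impI)
      fix N k assume "\<forall>k\<ge>N. \<bar>x + h - X k\<bar> < r \<and> \<bar>x - X k\<bar> < r" "N \<le> k"
      then have near: "\<bar>x + h - X k\<bar> < r" "\<bar>x - X k\<bar> < r" by auto
      have "norm ((f (x + h) (Y k) - f (X k) (Y k) - q * (x + h - X k)) - (f x (Y k) - f (X k) (Y k) - q * (x - X k)))
          \<le> \<eta> * \<bar>x + h - X k\<bar> + \<eta> * \<bar>x - X k\<bar>"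
        using cross_setD_x[OF XY near(1) h(2)] cross_setD_x[OF XY near(2) sq(1)]
        by (intro order.trans[OF norm_triangle_ineq4 add_mono]) (simp_all add: algebra_simps)
      then show "norm (f (x + h) (Y k) - f x (Y k) - q * h) \<le> \<eta> * \<bar>x + h - X k\<bar> + \<eta> * \<bar>x - X k\<bar>"
        by (simp add: algebra_simps)
    qed
  qed
  have ver: "norm (f x (y + h) - f x y - \<i> * q * h) \<le> \<eta> * \<bar>h\<bar>" if h: "\<bar>h\<bar> < r" "\<bar>y + h\<bar> < s" for h
  proof (rule LIMSEQ_le)
    show "(\<lambda>k. norm (f (X k) (y + h) - f (X k) y - \<i> * q * h)) \<longlonglongrightarrow> norm (f x (y + h) - f x y - \<i> * q * h)"
      using h sq by (intro tendsto_intros isCont_tendsto_compose[of _ "\<lambda>x. f x _"] cont_x lim) auto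
    show "(\<lambda>k. \<eta> * \<bar>y + h - Y k\<bar> + \<eta> * \<bar>y - Y k\<bar>) \<longlonglongrightarrow> \<eta> * \<bar>h\<bar>"
    proof -
      have "(\<lambda>k. \<eta> * \<bar>y + h - Y k\<bar> + \<eta> * \<bar>y - Y k\<bar>) \<longlonglongrightarrow> \<eta> * \<bar>y + h - y\<bar> + \<eta> * \<bar>y - y\<bar>"
        by (intro tendsto_intros lim)
      then show ?thesis by simp
    qed
    have "(\<lambda>k. \<bar>y + h - Y k\<bar>) \<longlonglongrightarrow> \<bar>y + h - y\<bar>" "(\<lambda>k. \<bar>y - Y k\<bar>) \<longlonglongrightarrow> \<bar>y - y\<bar>"
      by (intro tendsto_intros lim)+
    then have "\<forall>\<^sub>F k in sequentially. \<bar>y + h - Y k\<bar> < r \<and> \<bar>y - Y k\<bar> < r"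
      using h(1) by (intro eventually_conj) (auto elim!: order_tendstoD(2))
    then show "\<exists>N. \<forall>k\<ge>N. norm (f (X k) (y + h) - f (X k) y - \<i> * q * h) \<le> \<eta> * \<bar>y + h - Y k\<bar> + \<eta> * \<bar>y - Y k\<bar>"
      unfolding eventually_sequentially
    proof (elim exE, intro exI allI impI)
      fix N k assume "\<forall>k\<ge>N. \<bar>y + h - Y k\<bar> < r \<and> \<bar>y - Y k\<bar> < r" "N \<le> k"
      then have near: "\<bar>y + h - Y k\<bar> < r" "\<bar>y - Y k\<bar> < r" by auto
      have "norm ((f (X k) (y + h) - f (X k) (Y k) - \<i> * q * (y + h - Y k)) - (f (X k) y - f (X k) (Y k) - \<i> * q * (y - Y k)))
          \<le> \<eta> * \<bar>y + h - Y k\<bar> + \<eta> * \<bar>y - Y k\<bar>"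
        using cross_setD_y[OF XY near(1) h(2)] cross_setD_y[OF XY near(2) sq(2)]
        by (intro order.trans[OF norm_triangle_ineq4 add_mono]) (simp_all add: algebra_simps)
      then show "norm (f (X k) (y + h) - f (X k) y - \<i> * q * h) \<le> \<eta> * \<bar>y + h - Y k\<bar> + \<eta> * \<bar>y - Y k\<bar>"
        by (simp add: algebra_simps)
    qed
  qed
  show ?thesis using hor ver assms(1) by (auto simp: cross_set_def)
qed

text \<open>For a countable \<open>Q\<close> this is the countable closed cover to which the Baire category theorem applies.\<close>

lemma cross_sets_cover:
  assumes Q: "\<And>U::complex set. open U \<Longrightarrow> U \<noteq> {} \<Longrightarrow> \<exists>q\<in>Q. q \<in> U"
    and "\<eta> > 0" and xy: "(x, y) \<in> square"
  obtains N :: nat and q where "q \<in> Q" "(x, y) \<in> cross_set \<eta> (1 / real (Suc N)) q"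
proof -
  have "ball (d x y) (\<eta> / 2) \<noteq> {}" using \<open>\<eta> > 0\<close> by simp
  from Q[OF open_ball this] obtain q where q: "q \<in> Q" "dist (d x y) q < \<eta> / 2" by auto
  have line: "\<exists>\<delta>>0. \<forall>h. \<bar>h\<bar> < \<delta> \<longrightarrow> norm (g (t + h) - g t - e * c * h) \<le> \<eta> * \<bar>h\<bar>"
    if g: "(g has_vector_derivative e * d x y) (at t)" and e: "norm e = 1" and c: "dist (d x y) c < \<eta> / 2"
    for g :: "real \<Rightarrow> complex" and t e c
  proof -
    obtain \<delta> where \<delta>: "\<delta> > 0" "\<And>u. norm (u - t) < \<delta> \<Longrightarrow>
        norm (g u - g t - (u - t) *\<^sub>R (e * d x y)) \<le> \<eta> / 2 * norm (u - t)"
      using g \<open>\<eta> > 0\<close> unfolding has_vector_derivative_def has_derivative_at_alt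
      by (metis half_gt_zero)
    have "norm (g (t + h) - g t - e * c * h) \<le> \<eta> * \<bar>h\<bar>" if h: "\<bar>h\<bar> < \<delta>" for h
    proof -
      have "g (t + h) - g t - e * c * h
          = (g (t + h) - g t - h *\<^sub>R (e * d x y)) + e * (d x y - c) * h"
        by (simp add: scaleR_conv_of_real algebra_simps)
      also have "norm \<dots> \<le> \<eta> / 2 * \<bar>h\<bar> + norm (d x y - c) * \<bar>h\<bar>"
        using \<delta>(2)[of "t + h"] h e
        by (intro order.trans[OF norm_triangle_ineq add_mono]) (auto simp: norm_mult)
      also have "\<dots> \<le> \<eta> / 2 * \<bar>h\<bar> + \<eta> / 2 * \<bar>h\<bar>"
        using c by (intro add_mono mult_right_mono) (auto simp: dist_norm)
      finally show ?thesis by simp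
    qed
    then show ?thesis using \<delta>(1) by blast
  qed
  obtain \<delta>1 where \<delta>1: "\<delta>1 > 0" "\<And>h. \<bar>h\<bar> < \<delta>1 \<Longrightarrow> norm (f (x + h) y - f x y - 1 * q * h) \<le> \<eta> * \<bar>h\<bar>"
    using line[of "\<lambda>t. f t y" 1 x q] deriv_x xy q(2) by (auto simp: square_def)
  obtain \<delta>2 where \<delta>2: "\<delta>2 > 0" "\<And>h. \<bar>h\<bar> < \<delta>2 \<Longrightarrow> norm (f x (y + h) - f x y - \<i> * q * h) \<le> \<eta> * \<bar>h\<bar>"
    using line[of "\<lambda>t. f x t" "\<i>" y q] deriv_y xy q(2) by (auto simp: square_def)
  obtain N where N: "1 / real (Suc N) < min \<delta>1 \<delta>2"
    using nat_approx_posE[of "min \<delta>1 \<delta>2"] \<delta>1(1) \<delta>2(1) by auto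
  have "(x, y) \<in> cross_set \<eta> (1 / real (Suc N)) q"
    using \<delta>1(2) \<delta>2(2) N xy unfolding cross_set_def by auto
  with q(1) show ?thesis by (rule that)
qed

text \<open>
  Each side of the rectangle lies on an axis-parallel line through a point of the cross set, so \<open>f\<close> is
  close to an affine function on this side, with an error proportional to \<open>\<eta>\<close>. Opposite sides are
  compared along the other arm of the cross at the given point of one of them.
\<close>

lemma cross_set_rect_integral_bound:
  assumes R: "-s < a" "a \<le> b" "b < s" "-s < c" "c \<le> e" "e < s" "b - a < r" "e - c < r"
    and \<eta>: "\<eta> \<ge> 0"
    and bottom: "(p, c) \<in> cross_set \<eta> r q" "a \<le> p" "p \<le> b"
    and top: "(p', e) \<in> cross_set \<eta> r q" "a \<le> p'" "p' \<le> b"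
    and left: "(a, t) \<in> cross_set \<eta> r q" "c \<le> t" "t \<le> e"
    and right: "(b, t') \<in> cross_set \<eta> r q" "c \<le> t'" "t' \<le> e"
  shows "norm (rect_integral f a b c e) \<le> \<eta> * (3 * (b - a)\<^sup>2 + 2 * (b - a) * (e - c) + 3 * (e - c)\<^sup>2)"
proof -
  have hor: "norm (f x c - f x e + \<i> * q * (e - c)) \<le> \<eta> * (3 * (b - a) + (e - c))" if x: "x \<in> {a..b}" for x
  proof -
    have 1: "norm (f x c - f p c - q * (x - p)) \<le> \<eta> * (b - a)"
      using x R bottom \<eta> by (intro order.trans[OF cross_setD_x[OF bottom(1)] mult_left_mono]) auto
    have 2: "norm (f x e - f p' e - q * (x - p')) \<le> \<eta> * (b - a)"
      using x R top \<eta> by (intro order.trans[OF cross_setD_x[OF top(1)] mult_left_mono]) auto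
    have 3: "norm (f p' c - f p c - q * (p' - p)) \<le> \<eta> * (b - a)"
      using top R bottom \<eta> by (intro order.trans[OF cross_setD_x[OF bottom(1)] mult_left_mono]) auto
    have 4: "norm (f p' c - f p' e - \<i> * q * (c - e)) \<le> \<eta> * (e - c)"
      using R \<eta> by (intro order.trans[OF cross_setD_y[OF top(1)] mult_left_mono]) auto
    have "norm (f x c - f x e + \<i> * q * (e - c)) = norm ((f x c - f p c - q * (x - p)) - (f x e - f p' e - q * (x - p'))
        - (f p' c - f p c - q * (p' - p)) + (f p' c - f p' e - \<i> * q * (c - e)))"
      by (simp add: algebra_simps)
    also have "\<dots> \<le> \<eta> * (b - a) + \<eta> * (b - a) + \<eta> * (b - a) + \<eta> * (e - c)"
      by (intro order.trans[OF norm_triangle_ineq] order.trans[OF norm_triangle_ineq4] add_mono 1 2 3 4)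
    finally show ?thesis by (simp add: algebra_simps)
  qed
  have ver: "norm (f b y - f a y - q * (b - a)) \<le> \<eta> * (3 * (e - c) + (b - a))" if y: "y \<in> {c..e}" for y
  proof -
    have 1: "norm (f a y - f a t - \<i> * q * (y - t)) \<le> \<eta> * (e - c)"
      using y R left \<eta> by (intro order.trans[OF cross_setD_y[OF left(1)] mult_left_mono]) auto
    have 2: "norm (f b y - f b t' - \<i> * q * (y - t')) \<le> \<eta> * (e - c)"
      using y R right \<eta> by (intro order.trans[OF cross_setD_y[OF right(1)] mult_left_mono]) auto
    have 3: "norm (f a t' - f a t - \<i> * q * (t' - t)) \<le> \<eta> * (e - c)"
      using left R right \<eta> by (intro order.trans[OF cross_setD_y[OF left(1)] mult_left_mono]) auto
    have 4: "norm (f a t' - f b t' - q * (a - b)) \<le> \<eta> * (b - a)"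
      using R \<eta> by (intro order.trans[OF cross_setD_x[OF right(1)] mult_left_mono]) auto
    have "norm (f b y - f a y - q * (b - a)) = norm ((f b y - f b t' - \<i> * q * (y - t')) - (f a y - f a t - \<i> * q * (y - t))
        + (f a t' - f a t - \<i> * q * (t' - t)) - (f a t' - f b t' - q * (a - b)))"
      by (simp add: algebra_simps)
    also have "\<dots> \<le> \<eta> * (e - c) + \<eta> * (e - c) + \<eta> * (e - c) + \<eta> * (b - a)"
      by (intro order.trans[OF norm_triangle_ineq] order.trans[OF norm_triangle_ineq4] add_mono 1 2 3 4)
    finally show ?thesis by (simp add: algebra_simps)
  qed
  have cx: "continuous_on {a..b} (\<lambda>x. f x c - f x e)" and cy: "continuous_on {c..e} (\<lambda>y. f b y - f a y)"
    using R by (auto intro!: continuous_intros cont_on_x cont_on_y)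
  have "integral {a..b} (\<lambda>x. f x c - f x e + \<i> * q * (e - c))
      = integral {a..b} (\<lambda>x. f x c - f x e) + integral {a..b} (\<lambda>x. \<i> * q * (e - c))"
    using cx by (intro Henstock_Kurzweil_Integration.integral_add integrable_continuous_real) auto
  then have ex: "integral {a..b} (\<lambda>x. f x c - f x e)
      = integral {a..b} (\<lambda>x. f x c - f x e + \<i> * q * (e - c)) - (b - a) * (\<i> * q * (e - c))"
    using R by (simp add: scaleR_conv_of_real)
  have "integral {c..e} (\<lambda>y. f b y - f a y - q * (b - a))
      = integral {c..e} (\<lambda>y. f b y - f a y) - integral {c..e} (\<lambda>y. q * (b - a))"
    using cy by (intro Henstock_Kurzweil_Integration.integral_diff integrable_continuous_real) auto
  then have ey: "integral {c..e} (\<lambda>y. f b y - f a y)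
      = integral {c..e} (\<lambda>y. f b y - f a y - q * (b - a)) + (e - c) * (q * (b - a))"
    using R by (simp add: scaleR_conv_of_real)
  \<comment> \<open>The linear function \<open>q z\<close> contributes nothing to the boundary integral.\<close>
  have "rect_integral f a b c e = integral {a..b} (\<lambda>x. f x c - f x e + \<i> * q * (e - c))
      + \<i> * integral {c..e} (\<lambda>y. f b y - f a y - q * (b - a))"
    unfolding rect_integral_def ex ey by (simp add: algebra_simps)
  also have "norm \<dots> \<le> \<eta> * (3 * (b - a) + (e - c)) * (b - a) + \<eta> * (3 * (e - c) + (b - a)) * (e - c)"
  proof (rule order.trans[OF norm_triangle_ineq add_mono])
    show "norm (integral {a..b} (\<lambda>x. f x c - f x e + \<i> * q * (e - c))) \<le> \<eta> * (3 * (b - a) + (e - c)) * (b - a)"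
      using hor R cx by (intro integral_bound) (auto intro!: continuous_intros)
    have "norm (integral {c..e} (\<lambda>y. f b y - f a y - q * (b - a))) \<le> \<eta> * (3 * (e - c) + (b - a)) * (e - c)"
      using ver R cy by (intro integral_bound) (auto intro!: continuous_intros)
    then show "norm (\<i> * integral {c..e} (\<lambda>y. f b y - f a y - q * (b - a))) \<le> \<eta> * (3 * (e - c) + (b - a)) * (e - c)"
      by (simp add: norm_mult)
  qed
  also have "\<dots> = \<eta> * (3 * (b - a)\<^sup>2 + 2 * (b - a) * (e - c) + 3 * (e - c)\<^sup>2)"
    by (simp add: algebra_simps power2_eq_square)
  finally show ?thesis .
qed

end

lemma measure_Int_rectangle_quarters:
  fixes D :: "(real \<times> real) set"
  assumes D: "D \<in> lmeasurable" and le: "a \<le> u" "u \<le> b" "c \<le> v" "v \<le> e"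
  shows "measure lebesgue (D \<inter> cbox (a, c) (b, e)) =
      measure lebesgue (D \<inter> cbox (a, c) (u, v)) + measure lebesgue (D \<inter> cbox (u, c) (b, v))
      + measure lebesgue (D \<inter> cbox (a, v) (u, e)) + measure lebesgue (D \<inter> cbox (u, v) (b, e))"
proof -
  have join: "measure lebesgue (D \<inter> A) = measure lebesgue (D \<inter> B) + measure lebesgue (D \<inter> C)"
    if "A = B \<union> C" "negligible (B \<inter> C)" "B \<in> lmeasurable" "C \<in> lmeasurable" for A B C :: "(real \<times> real) set"
  proof -
    have "measure lebesgue ((D \<inter> B) \<union> (D \<inter> C)) = measure lebesgue (D \<inter> B) + measure lebesgue (D \<inter> C)
        - measure lebesgue ((D \<inter> B) \<inter> (D \<inter> C))"
      using D that(3,4) by (intro measure_Un3 fmeasurable.Int)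
    moreover have "measure lebesgue ((D \<inter> B) \<inter> (D \<inter> C)) = 0"
      using that(2) by (intro negligible_imp_measure0) (rule negligible_subset, auto)
    ultimately show ?thesis using that(1) by (simp add: Int_Un_distrib)
  qed
  have ver: "measure lebesgue (D \<inter> cbox (a, p) (b, q))
      = measure lebesgue (D \<inter> cbox (a, p) (u, q)) + measure lebesgue (D \<inter> cbox (u, p) (b, q))" for p q
  proof (rule join)
    show "cbox (a, p) (b, q) = cbox (a, p) (u, q) \<union> cbox (u, p) (b, q)" using le by auto
    have "cbox (a, p) (u, q) \<inter> cbox (u, p) (b, q) = cbox (u, p) (u, q)" using le by auto
    moreover have "box (u, p) (u, q) = {}"
      unfolding box_eq_empty by (rule bexI[of _ "(1, 0)"]) (auto simp: Basis_prod_def)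
    ultimately show "negligible (cbox (a, p) (u, q) \<inter> cbox (u, p) (b, q))"
      by (simp add: negligible_interval)
  qed auto
  have hor: "measure lebesgue (D \<inter> cbox (p, c) (q, e))
      = measure lebesgue (D \<inter> cbox (p, c) (q, v)) + measure lebesgue (D \<inter> cbox (p, v) (q, e))" for p q
  proof (rule join)
    show "cbox (p, c) (q, e) = cbox (p, c) (q, v) \<union> cbox (p, v) (q, e)" using le by auto
    have "cbox (p, c) (q, v) \<inter> cbox (p, v) (q, e) = cbox (p, v) (q, v)" using le by auto
    moreover have "box (p, v) (q, v) = {}"
      unfolding box_eq_empty by (rule bexI[of _ "(0, 1)"]) (auto simp: Basis_prod_def)
    ultimately show "negligible (cbox (p, c) (q, v) \<inter> cbox (p, v) (q, e))"
      by (simp add: negligible_interval)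
  qed auto
  show ?thesis using ver[of c e] hor by simp
qed

context cauchy_riemann_square
begin

text \<open>
  The rectangle is replaced by the bounding box of its set \<open>K\<close> of points that are not tame. The four
  strips outside the box have tame interiors and contribute \<open>\<epsilon>\<close> times their area, the box contributes
  at most \<open>\<epsilon>\<close> times the area of the whole rectangle. The strips lie in the complement of \<open>K\<close>, so the
  excess over the desired bound is at most \<open>\<epsilon>\<close> times the measure of this complement, which is small after
  summation over a fine subdivision.
\<close>

lemma rect_integral_le_hit:
  assumes R: "-s < a" "a \<le> b" "b < s" "-s < c" "c \<le> e" "e < s" "b - a < r" "e - c < r"
    and fat: "b - a \<le> 2 * (e - c)" "e - c \<le> 2 * (b - a)" and \<epsilon>: "\<epsilon> \<ge> 0"
    and K: "K = cbox (a, c) (b, e) - tame \<epsilon>" "K \<noteq> {}" "K \<subseteq> cross_set (\<epsilon> / 14) r q"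
  shows "norm (rect_integral f a b c e) \<le> \<epsilon> * ((b - a) * (e - c)) + \<epsilon> * measure lebesgue (cbox (a, c) (b, e) - K)"
proof -
  have cK: "compact K"
    unfolding K(1) using open_tame by (intro compact_diff compact_cbox)
  obtain pl where pl: "pl \<in> K" "\<And>z. z \<in> K \<Longrightarrow> fst pl \<le> fst z"
    using continuous_attains_inf[OF cK K(2) continuous_on_fst[OF continuous_on_id]] by blast
  obtain pr where pr: "pr \<in> K" "\<And>z. z \<in> K \<Longrightarrow> fst z \<le> fst pr"
    using continuous_attains_sup[OF cK K(2) continuous_on_fst[OF continuous_on_id]] by blast
  obtain pb where pb: "pb \<in> K" "\<And>z. z \<in> K \<Longrightarrow> snd pb \<le> snd z"
    using continuous_attains_inf[OF cK K(2) continuous_on_snd[OF continuous_on_id]] by blast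
  obtain pt where pt: "pt \<in> K" "\<And>z. z \<in> K \<Longrightarrow> snd z \<le> snd pt"
    using continuous_attains_sup[OF cK K(2) continuous_on_snd[OF continuous_on_id]] by blast
  define a' b' c' e' where "a' = fst pl" and "b' = fst pr" and "c' = snd pb" and "e' = snd pt"
  have K_box: "K \<subseteq> cbox (a', c') (b', e')"
    using pl(2) pr(2) pb(2) pt(2) by (auto simp: a'_def b'_def c'_def e'_def)
  have in_box: "a \<le> fst z" "fst z \<le> b" "c \<le> snd z" "snd z \<le> e" if "z \<in> K" for z
    using that unfolding K(1) by (cases z; auto)+
  have ord: "a \<le> a'" "a' \<le> b'" "b' \<le> b" "c \<le> c'" "c' \<le> e'" "e' \<le> e"
    using in_box[OF pl(1)] in_box[OF pr(1)] in_box[OF pb(1)] in_box[OF pt(1)] pl(2)[OF pr(1)] pb(2)[OF pt(1)]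
    by (auto simp: a'_def b'_def c'_def e'_def)
  have strip: "norm (rect_integral f u v w z) \<le> \<epsilon> * ((v - u) * (z - w))"
    if "a \<le> u" "u \<le> v" "v \<le> b" "c \<le> w" "w \<le> z" "z \<le> e"
      and "v \<le> a' \<or> b' \<le> u \<or> z \<le> c' \<or> e' \<le> w" for u v w z
  proof (rule rect_integral_le_open)
    show "{u<..<v} \<times> {w<..<z} \<subseteq> tame \<epsilon>"
    proof
      fix p assume p: "p \<in> {u<..<v} \<times> {w<..<z}"
      then have "p \<in> cbox (a, c) (b, e)" "p \<notin> cbox (a', c') (b', e')"
        using that by (cases p; auto)+
      then show "p \<in> tame \<epsilon>" using K_box unfolding K(1) by blast
    qed
  qed (use that R in auto)
  have split: "rect_integral f a b c e = rect_integral f a a' c e + rect_integral f b' b c e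
      + rect_integral f a' b' c c' + rect_integral f a' b' e' e + rect_integral f a' b' c' e'"
    using rect_integral_split_x[of a a' b c e] rect_integral_split_x[of a' b' b c e]
      rect_integral_split_y[of c c' e a' b'] rect_integral_split_y[of c' e' e a' b'] R ord by simp
  have core: "norm (rect_integral f a' b' c' e') \<le> \<epsilon> * ((b - a) * (e - c))"
  proof -
    have "norm (rect_integral f a' b' c' e')
        \<le> \<epsilon> / 14 * (3 * (b' - a')\<^sup>2 + 2 * (b' - a') * (e' - c') + 3 * (e' - c')\<^sup>2)"
    proof (rule cross_set_rect_integral_bound)
      show "(fst pb, c') \<in> cross_set (\<epsilon> / 14) r q" "(fst pt, e') \<in> cross_set (\<epsilon> / 14) r q"
        "(a', snd pl) \<in> cross_set (\<epsilon> / 14) r q" "(b', snd pr) \<in> cross_set (\<epsilon> / 14) r q"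
        using pl(1) pr(1) pb(1) pt(1) K(3) by (auto simp: a'_def b'_def c'_def e'_def)
    qed (use R ord \<epsilon> pl pr pb pt in \<open>auto simp: a'_def b'_def c'_def e'_def\<close>)
    \<comment> \<open>The number 14 is \<open>3 * 2 + 2 + 3 * 2\<close>: the square of a side is at most twice the area.\<close>
    also have "\<dots> \<le> \<epsilon> / 14 * (3 * (2 * ((b - a) * (e - c))) + 2 * ((b - a) * (e - c)) + 3 * (2 * ((b - a) * (e - c))))"
    proof (intro mult_left_mono add_mono)
      have "(b' - a')\<^sup>2 \<le> (b - a) * (2 * (e - c))"
        unfolding power2_eq_square using ord fat R by (intro mult_mono) auto
      then show "(b' - a')\<^sup>2 \<le> 2 * ((b - a) * (e - c))" by (simp add: algebra_simps)
      have "(e' - c')\<^sup>2 \<le> (2 * (b - a)) * (e - c)"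
        unfolding power2_eq_square using ord fat R by (intro mult_mono) auto
      then show "(e' - c')\<^sup>2 \<le> 2 * ((b - a) * (e - c))" by (simp add: algebra_simps)
      have "(b' - a') * (e' - c') \<le> (b - a) * (e - c)"
        using ord R by (intro mult_mono) auto
      then show "2 * (b' - a') * (e' - c') \<le> 2 * ((b - a) * (e - c))" by (simp add: algebra_simps)
    qed (use \<epsilon> in auto)
    also have "\<dots> = \<epsilon> * ((b - a) * (e - c))" by (simp add: algebra_simps)
    finally show ?thesis .
  qed
  have "norm (rect_integral f a b c e) \<le> norm (rect_integral f a a' c e) + norm (rect_integral f b' b c e)
      + norm (rect_integral f a' b' c c') + norm (rect_integral f a' b' e' e) + norm (rect_integral f a' b' c' e')"
    unfolding split by (meson norm_triangle_le order_refl add_mono)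
  also have "\<dots> \<le> \<epsilon> * ((a' - a) * (e - c)) + \<epsilon> * ((b - b') * (e - c)) + \<epsilon> * ((b' - a') * (c' - c))
      + \<epsilon> * ((b' - a') * (e - e')) + \<epsilon> * ((b - a) * (e - c))"
    using ord by (intro add_mono strip core) auto
  also have "\<dots> = \<epsilon> * ((b - a) * (e - c)) + \<epsilon> * ((b - a) * (e - c) - (b' - a') * (e' - c'))"
    by (simp add: algebra_simps)
  also have "\<dots> \<le> \<epsilon> * ((b - a) * (e - c)) + \<epsilon> * measure lebesgue (cbox (a, c) (b, e) - K)"
  proof (rule add_left_mono, rule mult_left_mono[OF _ \<epsilon>])
    have meas: "measure lebesgue (cbox (u, w) (v, z)) = (v - u) * (z - w)" if "u \<le> v" "w \<le> z" for u v w z :: real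
      using that content_Pair[of u w v z] by (simp add: measure_lborel_cbox_eq)
    have "measure lebesgue K \<le> measure lebesgue (cbox (a', c') (b', e'))"
      using K_box cK by (intro measure_mono_fmeasurable) (auto simp: lmeasurable_compact fmeasurableD)
    then have "measure lebesgue K \<le> (b' - a') * (e' - c')"
      unfolding meas[OF ord(2,5)] .
    moreover have "measure lebesgue K + measure lebesgue (cbox (a, c) (b, e) - K) = measure lebesgue (cbox (a, c) (b, e))"
    proof -
      have "K \<union> cbox (a, c) (b, e) = cbox (a, c) (b, e)" unfolding K(1) by auto
      then show ?thesis
        using measure_Un2[OF lmeasurable_compact[OF cK] lmeasurable_cbox[of "(a, c)" "(b, e)"]] by simp
    qed
    moreover have "measure lebesgue (cbox (a, c) (b, e)) = (b - a) * (e - c)"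
      by (rule meas[OF R(2,5)])
    ultimately show "(b - a) * (e - c) - (b' - a') * (e' - c')
        \<le> measure lebesgue (cbox (a, c) (b, e) - K)"
      by linarith
  qed
  finally show ?thesis .
qed

text \<open>
  The excess in \<open>rect_integral_le_hit\<close> is additive over subdivisions, and for small rectangles it is
  confined to \<open>G - K\<close>, where \<open>G\<close> is an open superset of \<open>K\<close> with \<open>G - K\<close> of small measure.
\<close>

lemma rect_integral_le_fat:
  assumes R: "-s < x1" "x1 \<le> x2" "x2 < s" "-s < y1" "y1 \<le> y2" "y2 < s"
    and fat: "x2 - x1 \<le> 2 * (y2 - y1)" "y2 - y1 \<le> 2 * (x2 - x1)" and \<epsilon>: "\<epsilon> > 0" and r: "r > 0"
    and K: "cbox (x1, y1) (x2, y2) - tame \<epsilon> \<subseteq> cross_set (\<epsilon> / 14) r q"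
  shows "norm (rect_integral f x1 x2 y1 y2) \<le> \<epsilon> * ((x2 - x1) * (y2 - y1))"
proof (rule field_le_epsilon)
  fix \<tau> :: real assume \<tau>: "\<tau> > 0"
  define K where "K = cbox (x1, y1) (x2, y2) - tame \<epsilon>"
  have cK: "compact K"
    unfolding K_def using open_tame by (intro compact_diff compact_cbox)
  obtain G where G: "open G" "K \<subseteq> G" "G - K \<in> lmeasurable" "emeasure lebesgue (G - K) < ennreal (\<tau> / \<epsilon>)"
    by (rule sets_lebesgue_outer_open[of K "\<tau> / \<epsilon>"]) (use \<tau> \<epsilon> cK in \<open>auto simp: lmeasurable_compact fmeasurableD\<close>)
  define m where "m a b c e = measure lebesgue ((G - K) \<inter> cbox (a, c) (b, e))" for a b c e
  have m_nonneg: "m a b c e \<ge> 0" for a b c e by (simp add: m_def)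
  define P where "P a b c e \<longleftrightarrow> (x1 \<le> a \<and> a \<le> b \<and> b \<le> x2 \<and> y1 \<le> c \<and> c \<le> e \<and> e \<le> y2
      \<and> b - a \<le> 2 * (e - c) \<and> e - c \<le> 2 * (b - a) \<longrightarrow>
      norm (rect_integral f a b c e) \<le> \<epsilon> * ((b - a) * (e - c)) + \<epsilon> * m a b c e)" for a b c e
  have "P x1 x2 y1 y2"
  proof (rule quadrisection_induct[OF R(2,5)])
    fix a b c e :: real
    define u v where "u = (a + b) / 2" and "v = (c + e) / 2"
    assume le: "a \<le> b" "c \<le> e"
    assume quarters: "P a ((a + b) / 2) c ((c + e) / 2)" "P ((a + b) / 2) b c ((c + e) / 2)"
      "P a ((a + b) / 2) ((c + e) / 2) e" "P ((a + b) / 2) b ((c + e) / 2) e"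
    note quarters = quarters[folded u_def v_def]
    have uv: "a \<le> u" "u \<le> b" "c \<le> v" "v \<le> e" using le by (auto simp: u_def v_def)
    have half: "u - a = (b - a) / 2" "b - u = (b - a) / 2" "v - c = (e - c) / 2" "e - v = (e - c) / 2"
      by (auto simp: u_def v_def field_simps)
    show "P a b c e" unfolding P_def
    proof
      assume S: "x1 \<le> a \<and> a \<le> b \<and> b \<le> x2 \<and> y1 \<le> c \<and> c \<le> e \<and> e \<le> y2
          \<and> b - a \<le> 2 * (e - c) \<and> e - c \<le> 2 * (b - a)"
      have "rect_integral f a b c e = rect_integral f a u c v + rect_integral f u b c v
          + rect_integral f a u v e + rect_integral f u b v e"
        using S uv R by (intro rect_integral_quarters) auto
      also have "norm \<dots> \<le> norm (rect_integral f a u c v) + norm (rect_integral f u b c v)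
          + norm (rect_integral f a u v e) + norm (rect_integral f u b v e)"
        by (meson norm_triangle_le order_refl add_mono)
      also have "\<dots> \<le> (\<epsilon> * ((u - a) * (v - c)) + \<epsilon> * m a u c v) + (\<epsilon> * ((b - u) * (v - c)) + \<epsilon> * m u b c v)
          + (\<epsilon> * ((u - a) * (e - v)) + \<epsilon> * m a u v e) + (\<epsilon> * ((b - u) * (e - v)) + \<epsilon> * m u b v e)"
        using quarters S uv half unfolding P_def by (intro add_mono) (auto simp: half)
      also have "\<dots> = \<epsilon> * ((b - a) * (e - c)) + \<epsilon> * (m a u c v + m u b c v + m a u v e + m u b v e)"
        by (simp add: algebra_simps)
      also have "m a u c v + m u b c v + m a u v e + m u b v e = m a b c e"
        unfolding m_def by (rule measure_Int_rectangle_quarters[symmetric]) (use G uv in auto)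
      finally show "norm (rect_integral f a b c e) \<le> \<epsilon> * ((b - a) * (e - c)) + \<epsilon> * m a b c e" .
    qed
  next
    fix x y assume xy: "x1 \<le> x" "x \<le> x2" "y1 \<le> y" "y \<le> y2"
    show "\<exists>\<delta>>0. \<forall>a b c e. a \<le> x \<and> x \<le> b \<and> c \<le> y \<and> y \<le> e \<and> b - a < \<delta> \<and> e - c < \<delta> \<longrightarrow> P a b c e"
    proof (cases "(x, y) \<in> tame \<epsilon>")
      case True
      then obtain t where t: "t > 0"
        "\<And>a b c d. \<lbrakk>x - t < a; a \<le> b; b < x + t; y - t < c; c \<le> d; d < y + t\<rbrakk> \<Longrightarrow>
           norm (rect_integral f a b c d) \<le> \<epsilon> * ((b - a) * (d - c))"
        by (auto elim: tameD)
      have "P a b c e" if "a \<le> x" "x \<le> b" "c \<le> y" "y \<le> e" "b - a < t" "e - c < t" for a b c e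
      proof -
        have "norm (rect_integral f a b c e) \<le> \<epsilon> * ((b - a) * (e - c))"
          using that by (intro t(2)) auto
        then show ?thesis unfolding P_def using m_nonneg[of a b c e] \<epsilon> by (auto intro: add_increasing2)
      qed
      then show ?thesis using t(1) by blast
    next
      case False
      then have "(x, y) \<in> K" using xy by (auto simp: K_def)
      with G obtain t where t: "t > 0" "ball (x, y) t \<subseteq> G"
        by (meson openE subsetD)
      define \<delta> where "\<delta> = min r (t / 2)"
      have "P a b c e" if "a \<le> x" "x \<le> b" "c \<le> y" "y \<le> e" "b - a < \<delta>" "e - c < \<delta>" for a b c e
        unfolding P_def
      proof
        assume S: "x1 \<le> a \<and> a \<le> b \<and> b \<le> x2 \<and> y1 \<le> c \<and> c \<le> e \<and> e \<le> y2
            \<and> b - a \<le> 2 * (e - c) \<and> e - c \<le> 2 * (b - a)"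
        let ?K = "cbox (a, c) (b, e) - tame \<epsilon>"
        have "norm (rect_integral f a b c e) \<le> \<epsilon> * ((b - a) * (e - c)) + \<epsilon> * measure lebesgue (cbox (a, c) (b, e) - ?K)"
        proof (rule rect_integral_le_hit[where r = r and q = q])
          have "cbox (a, c) (b, e) \<subseteq> cbox (x1, y1) (x2, y2)" using S by auto
          then show "?K \<subseteq> cross_set (\<epsilon> / 14) r q" using K by blast
          have "(x, y) \<in> ?K" using False that by auto
          then show "?K \<noteq> {}" by blast
        qed (use S that R \<epsilon> in \<open>auto simp: \<delta>_def\<close>)
        also have "cbox (a, c) (b, e) - ?K = (G - K) \<inter> cbox (a, c) (b, e)"
        proof -
          have "cbox (a, c) (b, e) \<subseteq> G"
          proof
            fix p assume p: "p \<in> cbox (a, c) (b, e)"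
            have "dist (x, y) p \<le> \<bar>x - fst p\<bar> + \<bar>y - snd p\<bar>"
              by (cases p) (auto simp: dist_prod_def dist_real_def intro: sqrt_sum_squares_le_sum_abs)
            also have "\<dots> < t / 2 + t / 2"
              using p that by (cases p) (auto simp: \<delta>_def)
            finally show "p \<in> G" using t(2) by auto
          qed
          moreover have "cbox (a, c) (b, e) \<subseteq> cbox (x1, y1) (x2, y2)" using S by auto
          ultimately show ?thesis unfolding K_def by blast
        qed
        finally show "norm (rect_integral f a b c e) \<le> \<epsilon> * ((b - a) * (e - c)) + \<epsilon> * m a b c e"
          by (simp add: m_def)
      qed
      moreover have "\<delta> > 0" using t(1) r by (simp add: \<delta>_def)
      ultimately show ?thesis by blast
    qed
  qed
  then have "norm (rect_integral f x1 x2 y1 y2) \<le> \<epsilon> * ((x2 - x1) * (y2 - y1)) + \<epsilon> * m x1 x2 y1 y2"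
    using R fat by (simp add: P_def)
  moreover have "m x1 x2 y1 y2 \<le> \<tau> / \<epsilon>"
  proof -
    have "m x1 x2 y1 y2 \<le> measure lebesgue (G - K)"
      unfolding m_def using G(3) by (intro measure_mono_fmeasurable) auto
    also have "\<dots> \<le> \<tau> / \<epsilon>"
      using G(3,4) \<tau> \<epsilon> by (simp add: emeasure_eq_measure2 ennreal_less_iff)
    finally show ?thesis .
  qed
  then have "\<epsilon> * m x1 x2 y1 y2 \<le> \<tau>" using \<epsilon> by (simp add: field_simps)
  ultimately show "norm (rect_integral f x1 x2 y1 y2) \<le> \<epsilon> * ((x2 - x1) * (y2 - y1)) + \<tau>" by linarith
qed

text \<open>Halving the longer side turns an arbitrary rectangle into rectangles with comparable sides.\<close>

lemma rect_integral_le_portion: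
  assumes R: "-s < x1" "x1 \<le> x2" "x2 < s" "-s < y1" "y1 \<le> y2" "y2 < s"
    and \<epsilon>: "\<epsilon> > 0" and r: "r > 0"
    and K: "cbox (x1, y1) (x2, y2) - tame \<epsilon> \<subseteq> cross_set (\<epsilon> / 14) r q"
  shows "norm (rect_integral f x1 x2 y1 y2) \<le> \<epsilon> * ((x2 - x1) * (y2 - y1))"
proof (cases "x1 = x2 \<or> y1 = y2")
  case True
  then show ?thesis by (auto simp: rect_integral_degenerate)
next
  case False
  have *: "norm (rect_integral f a b c e) \<le> \<epsilon> * ((b - a) * (e - c))"
    if "b - a \<le> 2 ^ Suc k * (e - c)" "e - c \<le> 2 ^ Suc k * (b - a)" "x1 \<le> a" "a \<le> b" "b \<le> x2" "y1 \<le> c" "c \<le> e" "e \<le> y2"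
    for k a b c e
    using that
  proof (induction k arbitrary: a b c e)
    case 0
    have "cbox (a, c) (b, e) \<subseteq> cbox (x1, y1) (x2, y2)" using 0 by auto
    then have "cbox (a, c) (b, e) - tame \<epsilon> \<subseteq> cross_set (\<epsilon> / 14) r q" using K by blast
    then show ?case using 0 R \<epsilon> r by (intro rect_integral_le_fat) auto
  next
    case (Suc k)
    define u v where "u = (a + b) / 2" and "v = (c + e) / 2"
    have half: "u - a = (b - a) / 2" "b - u = (b - a) / 2" "v - c = (e - c) / 2" "e - v = (e - c) / 2"
      by (auto simp: u_def v_def field_simps)
    have uv: "a \<le> u" "u \<le> b" "c \<le> v" "v \<le> e" using Suc.prems by (auto simp: u_def v_def)
    have pow: "1 \<le> (2::real) ^ Suc k" by (rule one_le_power) simp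
    have wid: "z \<le> 2 ^ Suc k * z" if "z \<ge> 0" for z :: real
      using mult_right_mono[OF pow that] by simp
    consider "b - a > 2 * (e - c)" | "e - c > 2 * (b - a)" | "b - a \<le> 2 * (e - c)" "e - c \<le> 2 * (b - a)" by linarith
    then show ?case
    proof cases
      case 1
      have "e - c \<le> 2 ^ Suc k * ((b - a) / 2)"
        using 1 Suc.prems order.trans[OF _ wid[of "(b - a) / 2"], of "e - c"] by auto
      moreover have "(b - a) / 2 \<le> 2 ^ Suc k * (e - c)"
        using Suc.prems(1) by simp
      ultimately have asp: "u - a \<le> 2 ^ Suc k * (e - c)" "e - c \<le> 2 ^ Suc k * (u - a)"
        "b - u \<le> 2 ^ Suc k * (e - c)" "e - c \<le> 2 ^ Suc k * (b - u)"
        by (simp_all only: half)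
      have "norm (rect_integral f a u c e) \<le> \<epsilon> * ((u - a) * (e - c))"
        "norm (rect_integral f u b c e) \<le> \<epsilon> * ((b - u) * (e - c))"
        using Suc.IH[OF asp(1,2)] Suc.IH[OF asp(3,4)] Suc.prems(3-) uv by simp_all
      moreover have "rect_integral f a b c e = rect_integral f a u c e + rect_integral f u b c e"
        using Suc.prems uv R by (intro rect_integral_split_x) auto
      moreover have "\<epsilon> * ((u - a) * (e - c)) + \<epsilon> * ((b - u) * (e - c)) = \<epsilon> * ((b - a) * (e - c))"
        by (simp add: algebra_simps)
      ultimately show ?thesis
        using norm_triangle_ineq[of "rect_integral f a u c e" "rect_integral f u b c e"] by simp
    next
      case 2
      have "b - a \<le> 2 ^ Suc k * ((e - c) / 2)"
        using 2 Suc.prems order.trans[OF _ wid[of "(e - c) / 2"], of "b - a"] by auto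
      moreover have "(e - c) / 2 \<le> 2 ^ Suc k * (b - a)"
        using Suc.prems(2) by simp
      ultimately have asp: "b - a \<le> 2 ^ Suc k * (v - c)" "v - c \<le> 2 ^ Suc k * (b - a)"
        "b - a \<le> 2 ^ Suc k * (e - v)" "e - v \<le> 2 ^ Suc k * (b - a)"
        by (simp_all only: half)
      have "norm (rect_integral f a b c v) \<le> \<epsilon> * ((b - a) * (v - c))"
        "norm (rect_integral f a b v e) \<le> \<epsilon> * ((b - a) * (e - v))"
        using Suc.IH[OF asp(1,2)] Suc.IH[OF asp(3,4)] Suc.prems(3-) uv by simp_all
      moreover have "rect_integral f a b c e = rect_integral f a b c v + rect_integral f a b v e"
        using Suc.prems uv R by (intro rect_integral_split_y) auto
      moreover have "\<epsilon> * ((b - a) * (v - c)) + \<epsilon> * ((b - a) * (e - v)) = \<epsilon> * ((b - a) * (e - c))"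
        by (simp add: algebra_simps)
      ultimately show ?thesis
        using norm_triangle_ineq[of "rect_integral f a b c v" "rect_integral f a b v e"] by simp
    next
      case 3
      have "b - a \<le> 2 ^ Suc k * (e - c)" "e - c \<le> 2 ^ Suc k * (b - a)"
      proof -
        have "2 * z \<le> 2 ^ Suc k * z" if "z \<ge> 0" for z :: real
          using that by (intro mult_right_mono) auto
        then show "b - a \<le> 2 ^ Suc k * (e - c)" "e - c \<le> 2 ^ Suc k * (b - a)"
          using 3 Suc.prems by (meson diff_ge_0_iff_ge order.trans)+
      qed
      then show ?thesis using Suc.prems by (intro Suc.IH) auto
    qed
  qed
  obtain k :: nat where k: "(x2 - x1) / (y2 - y1) + (y2 - y1) / (x2 - x1) < 2 ^ k"
    using real_arch_pow[of 2 "(x2 - x1) / (y2 - y1) + (y2 - y1) / (x2 - x1)"] by auto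
  have less: "x1 < x2" "y1 < y2" using False R by auto
  have "(x2 - x1) / (y2 - y1) > 0" "(y2 - y1) / (x2 - x1) > 0" using less by auto
  moreover have "(2::real) ^ k \<le> 2 ^ Suc k" by simp
  ultimately have "(x2 - x1) / (y2 - y1) \<le> 2 ^ Suc k" "(y2 - y1) / (x2 - x1) \<le> 2 ^ Suc k"
    using k by linarith+
  then have "x2 - x1 \<le> 2 ^ Suc k * (y2 - y1)" "y2 - y1 \<le> 2 ^ Suc k * (x2 - x1)"
    using less by (auto simp: pos_divide_le_eq)
  then show ?thesis using R by (intro *) auto
qed

text \<open>
  The set \<open>C\<close> of points that are not tame is closed in the open square, so the Baire category theorem
  applies to it: one of the countably many cross sets contains a nonempty relatively open part
  of \<open>C\<close>. By \<open>rect_integral_le_portion\<close> the points of this part would be tame.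
\<close>

lemma tame_eq_square:
  assumes \<epsilon>: "\<epsilon> > 0"
  shows "tame \<epsilon> = square"
proof (rule ccontr)
  assume "tame \<epsilon> \<noteq> square"
  define C where "C = square - tame \<epsilon>"
  have "C \<noteq> {}" using \<open>tame \<epsilon> \<noteq> square\<close> tame_subset by (auto simp: C_def)
  obtain Q :: "complex set" where Q: "countable Q" "\<And>U. open U \<Longrightarrow> U \<noteq> {} \<Longrightarrow> \<exists>q\<in>Q. q \<in> U"
    using countable_dense_exists[where 'a = complex] by auto
  define \<G> where "\<G> = (\<lambda>(N, q). C \<inter> cross_set (\<epsilon> / 14) (1 / real (Suc N)) q) ` (UNIV \<times> Q)"
  have "C \<subseteq> \<Union>\<G>"
  proof
    fix p assume p: "p \<in> C"
    obtain x y where xy: "p = (x, y)" by (cases p)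
    have xy_square: "(x, y) \<in> square" using p xy by (simp add: C_def)
    obtain N q where "q \<in> Q" "(x, y) \<in> cross_set (\<epsilon> / 14) (1 / real (Suc N)) q"
      by (rule cross_sets_cover[of Q "\<epsilon> / 14" x y]) (use Q(2) \<epsilon> xy_square in auto)
    then show "p \<in> \<Union>\<G>" using p xy unfolding \<G>_def by force
  qed
  moreover have "\<Union>\<G> \<subseteq> C" by (auto simp: \<G>_def)
  ultimately have union: "\<Union>\<G> = C" by blast
  have closed: "closedin (top_of_set C) T" if T: "T \<in> \<G>" for T
  proof -
    obtain N q where T_eq: "T = C \<inter> cross_set (\<epsilon> / 14) (1 / real (Suc N)) q"
      using T by (auto simp: \<G>_def)
    have "C \<inter> closure (cross_set (\<epsilon> / 14) (1 / real (Suc N)) q) = T"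
      unfolding T_eq C_def using cross_set_closed closure_subset by fastforce
    then show ?thesis by (metis closedin_closed_Int closed_closure)
  qed
  have "completely_metrizable_space (top_of_set C)"
  proof -
    have "completely_metrizable_space (top_of_set square)"
      using open_square by (intro completely_metrizable_space_openin completely_metrizable_space_euclidean) simp
    moreover have "closedin (top_of_set square) C"
      using open_tame closedin_closed_Int[of "- tame \<epsilon>" square] by (simp add: C_def Diff_eq closed_Compl)
    ultimately have "completely_metrizable_space (subtopology (top_of_set square) C)"
      by (rule completely_metrizable_space_closedin)
    moreover have "square \<inter> C = C" by (auto simp: C_def)
    ultimately show ?thesis by (simp add: subtopology_subtopology)
  qed
  moreover have "countable \<G>" unfolding \<G>_def using Q(1) by auto
  moreover have "top_of_set C interior_of \<Union>\<G> \<noteq> {}"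
    unfolding union using \<open>C \<noteq> {}\<close> interior_of_topspace[of "top_of_set C"] by simp
  ultimately obtain T where T: "T \<in> \<G>" "top_of_set C interior_of T \<noteq> {}"
    using Baire_category_alt[of "top_of_set C" \<G>] closed by blast
  obtain N q where T_eq: "T = C \<inter> cross_set (\<epsilon> / 14) (1 / real (Suc N)) q"
    using T(1) by (auto simp: \<G>_def)
  obtain S where S: "openin (top_of_set C) S" "S \<noteq> {}" "S \<subseteq> T"
    using T(2) by (metis interior_of_subset openin_interior_of)
  obtain U where U: "open U" "S = C \<inter> U"
    using S(1) by (auto simp: openin_open)
  obtain x y where xy: "(x, y) \<in> S" using S(2) by auto
  then have "(x, y) \<in> U \<inter> square" using U by (auto simp: C_def)
  then obtain r where r: "r > 0" "ball (x, y) r \<subseteq> U \<inter> square"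
    using U(1) open_square by (meson open_Int openE)
  have box: "(u, v) \<in> U \<inter> square" if "\<bar>u - x\<bar> < r / 2" "\<bar>v - y\<bar> < r / 2" for u v
  proof -
    have "dist (x, y) (u, v) \<le> \<bar>x - u\<bar> + \<bar>y - v\<bar>"
      by (auto simp: dist_prod_def dist_real_def intro: sqrt_sum_squares_le_sum_abs)
    also have "\<dots> < r" using that by linarith
    finally show ?thesis using r(2) by auto
  qed
  have "(x, y) \<in> tame \<epsilon>"
    unfolding tame_def
  proof (intro CollectI case_prodI exI conjI allI impI)
    show "0 < r / 2" using r by simp
    show "\<bar>x\<bar> + r / 2 \<le> s"
    proof (rule field_le_epsilon)
      fix t :: real assume t: "t > 0"
      define w where "w = max 0 (r / 2 - t)"
      have w: "0 \<le> w" "w < r / 2" "r / 2 \<le> w + t" using t r(1) by (auto simp: w_def max_def)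
      then have "\<bar>x + w\<bar> < s" "\<bar>x - w\<bar> < s" using box[of "x + w" y] box[of "x - w" y] r(1) by (auto simp: square_def)
      then show "\<bar>x\<bar> + r / 2 \<le> s + t" using w by linarith
    qed
    show "\<bar>y\<bar> + r / 2 \<le> s"
    proof (rule field_le_epsilon)
      fix t :: real assume t: "t > 0"
      define w where "w = max 0 (r / 2 - t)"
      have w: "0 \<le> w" "w < r / 2" "r / 2 \<le> w + t" using t r(1) by (auto simp: w_def max_def)
      then have "\<bar>y + w\<bar> < s" "\<bar>y - w\<bar> < s" using box[of x "y + w"] box[of x "y - w"] r(1) by (auto simp: square_def)
      then show "\<bar>y\<bar> + r / 2 \<le> s + t" using w by linarith
    qed
    fix a b c d
    assume R: "x - r / 2 < a \<and> a \<le> b \<and> b < x + r / 2 \<and> y - r / 2 < c \<and> c \<le> d \<and> d < y + r / 2"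
    have in_U: "cbox (a, c) (b, d) \<subseteq> U \<inter> square"
    proof
      fix p assume "p \<in> cbox (a, c) (b, d)"
      moreover obtain u v where p: "p = (u, v)" by (cases p)
      ultimately have "a \<le> u \<and> u \<le> b \<and> c \<le> v \<and> v \<le> d" by simp
      with R have "\<bar>u - x\<bar> < r / 2" "\<bar>v - y\<bar> < r / 2" by arith+
      with p show "p \<in> U \<inter> square" using box[of u v] by simp
    qed
    have corners: "(a, c) \<in> square" "(b, d) \<in> square"
      using R subsetD[OF in_U, of "(a, c)"] subsetD[OF in_U, of "(b, d)"] by auto
    have "cbox (a, c) (b, d) - tame \<epsilon> \<subseteq> cross_set (\<epsilon> / 14) (1 / real (Suc N)) q"
      using in_U S(3) unfolding U(2) T_eq C_def by blast
    then show "norm (rect_integral f a b c d) \<le> \<epsilon> * ((b - a) * (d - c))"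
      using R corners \<epsilon> by (intro rect_integral_le_portion) (auto simp: square_def)
  qed
  then show False using xy U(2) by (auto simp: C_def)
qed

theorem rect_integral_eq_0:
  assumes R: "-s < x1" "x1 \<le> x2" "x2 < s" "-s < y1" "y1 \<le> y2" "y2 < s"
  shows "rect_integral f x1 x2 y1 y2 = 0"
proof -
  define A where "A = (x2 - x1) * (y2 - y1)"
  have A: "A \<ge> 0" using R by (simp add: A_def)
  have le: "norm (rect_integral f x1 x2 y1 y2) \<le> \<epsilon> * A" if "\<epsilon> > 0" for \<epsilon>
    unfolding A_def using R that by (intro rect_integral_le_closed) (auto simp: tame_eq_square square_def)
  have "norm (rect_integral f x1 x2 y1 y2) \<le> \<tau>" if "\<tau> > 0" for \<tau>
  proof -
    have "norm (rect_integral f x1 x2 y1 y2) \<le> \<tau> / (A + 1) * A"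
      using that A by (intro le) simp
    also have "\<dots> \<le> \<tau>" using that A by (simp add: field_simps)
    finally show ?thesis .
  qed
  then have "norm (rect_integral f x1 x2 y1 y2) \<le> 0"
    by (rule dense_ge)
  then show ?thesis by simp
qed

end

section \<open>From vanishing boundary integrals to holomorphy\<close>

text \<open>The mean value inequality for \<open>g\<close> minus the linear function with slope \<open>c\<close>.\<close>

lemma vector_derivative_deviation_bound:
  fixes g :: "real \<Rightarrow> 'a::real_normed_vector"
  assumes g: "\<And>t. t \<in> closed_segment a b \<Longrightarrow> (g has_vector_derivative g' t) (at t)"
    and B: "\<And>t. t \<in> closed_segment a b \<Longrightarrow> norm (g' t - c) \<le> B"
  shows "norm (g b - g a - (b - a) *\<^sub>R c) \<le> B * \<bar>b - a\<bar>"
proof -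
  have "norm ((g b - b *\<^sub>R c) - (g a - a *\<^sub>R c)) \<le> B * norm (b - a)"
  proof (rule differentiable_bound[OF convex_closed_segment])
    fix t assume t: "t \<in> closed_segment a b"
    have "((\<lambda>t. g t - t *\<^sub>R c) has_vector_derivative g' t - 1 *\<^sub>R c) (at t)"
      by (rule has_vector_derivative_diff[OF g[OF t]]) (auto intro!: derivative_eq_intros)
    then show "((\<lambda>t. g t - t *\<^sub>R c) has_derivative (\<lambda>h. h *\<^sub>R (g' t - c))) (at t within closed_segment a b)"
      by (simp add: has_vector_derivative_def has_derivative_at_withinI)
    show "onorm (\<lambda>h. h *\<^sub>R (g' t - c)) \<le> B"
    proof (rule onorm_le)
      fix h :: real
      have "\<bar>h\<bar> * norm (g' t - c) \<le> \<bar>h\<bar> * B" by (rule mult_left_mono[OF B[OF t]]) simp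
      then show "norm (h *\<^sub>R (g' t - c)) \<le> B * norm h" by (simp add: mult.commute)
    qed
  qed auto
  then show ?thesis by (simp add: algebra_simps)
qed

context cauchy_riemann_square
begin

text \<open>
  Integration along the two L-shaped paths from a corner gives the same value, because the
  boundary integral over the rectangle between them vanishes. One path shows the derivative in the
  direction of \<open>y\<close>, the other the derivative in the direction of \<open>x\<close>. The primitive is again
  an instance of the locale, which allows the construction to be repeated.
\<close>

lemma primitive_exists:
  assumes b: "0 < b" "b < s"
  obtains F M' where "cauchy_riemann_square F f b M'"
proof -
  define F where "F x y = integral {-b..x} (\<lambda>t. f t (-b)) + \<i> * integral {-b..y} (\<lambda>t. f x t)" for x y
  have ix: "(\<lambda>t. f t y) integrable_on {u..v}" if "-b \<le> u" "v \<le> b" "\<bar>y\<bar> \<le> b" for u v y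
    using that b by (intro integrable_continuous_real cont_on_x) auto
  have iy: "(\<lambda>t. f x t) integrable_on {u..v}" if "-b \<le> u" "v \<le> b" "\<bar>x\<bar> \<le> b" for u v x
    using that b by (intro integrable_continuous_real cont_on_y) auto
  have alt: "F x y = \<i> * integral {-b..y} (\<lambda>t. f (-b) t) + integral {-b..x} (\<lambda>t. f t y)"
    if "\<bar>x\<bar> < b" "\<bar>y\<bar> < b" for x y
  proof -
    have hor: "integral {-b..x} (\<lambda>t. f t (-b) - f t y) = integral {-b..x} (\<lambda>t. f t (-b)) - integral {-b..x} (\<lambda>t. f t y)"
      using that by (intro Henstock_Kurzweil_Integration.integral_diff ix) auto
    have ver: "integral {-b..y} (\<lambda>t. f x t - f (-b) t) = integral {-b..y} (\<lambda>t. f x t) - integral {-b..y} (\<lambda>t. f (-b) t)"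
      using that by (intro Henstock_Kurzweil_Integration.integral_diff iy) auto
    have "F x y - (\<i> * integral {-b..y} (\<lambda>t. f (-b) t) + integral {-b..x} (\<lambda>t. f t y))
        = rect_integral f (-b) x (-b) y"
      unfolding rect_integral_def F_def hor ver right_diff_distrib by simp
    also have "\<dots> = 0"
      using that b by (intro rect_integral_eq_0) auto
    finally show ?thesis by simp
  qed
  have interior: "((\<lambda>u. integral {-b..u} g) has_vector_derivative g x) (at x)"
    if "continuous_on {-b..b} g" "\<bar>x\<bar> < b" for g :: "real \<Rightarrow> complex" and x
  proof -
    have "((\<lambda>u. integral {-b..u} g) has_vector_derivative g x) (at x within {-b..b})"
      using that by (intro integral_has_vector_derivative) auto
    moreover have "at x within {-b..b} = at x" using that by (intro at_within_interior) auto
    ultimately show ?thesis by simp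
  qed
  show ?thesis
  proof
    show "cauchy_riemann_square F f b (M * (2 * b) + M * (2 * b))"
    proof
      fix x y assume xy: "\<bar>x\<bar> < b" "\<bar>y\<bar> < b"
      have "((\<lambda>t. \<i> * integral {-b..y} (\<lambda>t. f (-b) t) + integral {-b..t} (\<lambda>t. f t y)) has_vector_derivative 0 + f x y) (at x)"
        using xy b by (intro has_vector_derivative_add has_vector_derivative_const interior cont_on_x) auto
      then show "((\<lambda>t. F t y) has_vector_derivative f x y) (at x)"
        unfolding add_0_left
        by (rule has_vector_derivative_transform_within_open[of _ _ _ "{-b<..<b}"])
          (use xy in \<open>auto simp: alt\<close>)
      have "((\<lambda>t. integral {-b..x} (\<lambda>t. f t (-b)) + \<i> * integral {-b..t} (\<lambda>t. f x t)) has_vector_derivative 0 + \<i> * f x y) (at y)"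
        using xy b by (intro has_vector_derivative_add has_vector_derivative_const has_vector_derivative_mult_right interior cont_on_y) auto
      then show "((\<lambda>t. F x t) has_vector_derivative \<i> * f x y) (at y)"
        by (simp add: F_def)
      have M: "M \<ge> 0" using order.trans[OF norm_ge_zero bounded[of x y]] xy b by auto
      have "norm (integral {-b..x} (\<lambda>t. f t (-b))) \<le> M * (x - (-b))"
        using xy b by (intro integral_bound cont_on_x) (auto intro!: bounded)
      also have "\<dots> \<le> M * (2 * b)" using M xy by (intro mult_left_mono) auto
      finally have 1: "norm (integral {-b..x} (\<lambda>t. f t (-b))) \<le> M * (2 * b)" .
      have "norm (integral {-b..y} (\<lambda>t. f x t)) \<le> M * (y - (-b))"
        using xy b by (intro integral_bound cont_on_y) (auto intro!: bounded)
      also have "\<dots> \<le> M * (2 * b)" using M xy by (intro mult_left_mono) auto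
      finally have 2: "norm (\<i> * integral {-b..y} (\<lambda>t. f x t)) \<le> M * (2 * b)" by (simp add: norm_mult)
      show "norm (F x y) \<le> M * (2 * b) + M * (2 * b)"
        unfolding F_def using 1 2 by (rule norm_triangle_le[OF add_mono])
    qed
  qed
qed

lemma bounded_partials_imp_Lipschitz:
  assumes d: "\<And>x y. \<bar>x\<bar> < s \<Longrightarrow> \<bar>y\<bar> < s \<Longrightarrow> norm (d x y) \<le> L"
    and xy: "\<bar>x\<bar> < s" "\<bar>y\<bar> < s" "\<bar>x'\<bar> < s" "\<bar>y'\<bar> < s"
  shows "norm (f x' y' - f x y) \<le> L * (\<bar>x' - x\<bar> + \<bar>y' - y\<bar>)"
proof -
  have seg: "\<bar>t\<bar> < s" if "t \<in> closed_segment u v" "\<bar>u\<bar> < s" "\<bar>v\<bar> < s" for t u v :: real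
    using that by (auto simp: closed_segment_eq_real_ivl split: if_splits)
  have "norm (f x' y' - f x y' - (x' - x) *\<^sub>R 0) \<le> L * \<bar>x' - x\<bar>"
    by (rule vector_derivative_deviation_bound[of _ _ "\<lambda>t. f t y'" "\<lambda>t. d t y'"])
      (use seg xy d in \<open>auto intro!: deriv_x\<close>)
  moreover have "norm (f x y' - f x y - (y' - y) *\<^sub>R 0) \<le> L * \<bar>y' - y\<bar>"
    by (rule vector_derivative_deviation_bound[of _ _ "\<lambda>t. f x t" "\<lambda>t. \<i> * d x t"])
      (use seg xy d in \<open>auto intro!: deriv_y simp: norm_mult\<close>)
  ultimately show ?thesis
    using norm_triangle_ineq[of "f x' y' - f x y'" "f x y' - f x y"] by (simp add: distrib_left)
qed

lemma continuous_partials_imp_complex_derivative: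
  assumes cont: "\<And>x y \<epsilon>. \<bar>x\<bar> < s \<Longrightarrow> \<bar>y\<bar> < s \<Longrightarrow> \<epsilon> > 0 \<Longrightarrow>
      \<exists>\<delta>>0. \<forall>x' y'. \<bar>x'\<bar> < s \<and> \<bar>y'\<bar> < s \<and> \<bar>x' - x\<bar> < \<delta> \<and> \<bar>y' - y\<bar> < \<delta> \<longrightarrow> norm (d x' y' - d x y) \<le> \<epsilon>"
    and z: "\<bar>Re z\<bar> < s" "\<bar>Im z\<bar> < s"
  shows "((\<lambda>z. f (Re z) (Im z)) has_field_derivative d (Re z) (Im z)) (at z)"
  unfolding has_field_derivative_def has_derivative_at_alt
proof (intro conjI allI impI)
  show "bounded_linear ((*) (d (Re z) (Im z)))" by (rule bounded_linear_mult_right)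
  fix e :: real assume e: "e > 0"
  let ?x = "Re z" and ?y = "Im z"
  obtain \<delta> where \<delta>: "\<delta> > 0" "\<And>x' y'. \<bar>x'\<bar> < s \<Longrightarrow> \<bar>y'\<bar> < s \<Longrightarrow> \<bar>x' - ?x\<bar> < \<delta> \<Longrightarrow> \<bar>y' - ?y\<bar> < \<delta> \<Longrightarrow>
      norm (d x' y' - d ?x ?y) \<le> e / 2"
    using cont[of ?x ?y "e / 2"] z e by (metis half_gt_zero)
  define \<rho> where "\<rho> = min \<delta> (min (s - \<bar>?x\<bar>) (s - \<bar>?y\<bar>))"
  have seg: "\<bar>t - u\<bar> \<le> \<bar>v - u\<bar>" if "t \<in> closed_segment u v" for t u v :: real
    using that by (auto simp: closed_segment_eq_real_ivl split: if_splits)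
  show "\<exists>\<rho>>0. \<forall>w. norm (w - z) < \<rho> \<longrightarrow>
      norm (f (Re w) (Im w) - f ?x ?y - d ?x ?y * (w - z)) \<le> e * norm (w - z)"
  proof (intro exI conjI allI impI)
    show "\<rho> > 0" using \<delta>(1) z by (simp add: \<rho>_def)
    fix w assume w: "norm (w - z) < \<rho>"
    let ?u = "Re w" and ?v = "Im w"
    have le: "\<bar>?u - ?x\<bar> \<le> norm (w - z)" "\<bar>?v - ?y\<bar> \<le> norm (w - z)"
      using abs_Re_le_cmod[of "w - z"] abs_Im_le_cmod[of "w - z"] by auto
    then have near: "\<bar>?u - ?x\<bar> < \<delta>" "\<bar>?v - ?y\<bar> < \<delta>" "\<bar>?u - ?x\<bar> < s - \<bar>?x\<bar>" "\<bar>?v - ?y\<bar> < s - \<bar>?y\<bar>"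
      using w by (auto simp: \<rho>_def)
    have 1: "norm (f ?u ?v - f ?x ?v - (?u - ?x) *\<^sub>R d ?x ?y) \<le> e / 2 * \<bar>?u - ?x\<bar>"
    proof (rule vector_derivative_deviation_bound)
      fix t assume "t \<in> closed_segment ?x ?u"
      from seg[OF this] have t: "\<bar>t\<bar> < s" "\<bar>t - ?x\<bar> < \<delta>" "\<bar>?v\<bar> < s" using near by linarith+
      then show "((\<lambda>t. f t ?v) has_vector_derivative d t ?v) (at t)" by (intro deriv_x)
      show "norm (d t ?v - d ?x ?y) \<le> e / 2" using t near by (intro \<delta>(2))
    qed
    have 2: "norm (f ?x ?v - f ?x ?y - (?v - ?y) *\<^sub>R (\<i> * d ?x ?y)) \<le> e / 2 * \<bar>?v - ?y\<bar>"
    proof (rule vector_derivative_deviation_bound)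
      fix t assume "t \<in> closed_segment ?y ?v"
      from seg[OF this] have t: "\<bar>t\<bar> < s" "\<bar>t - ?y\<bar> < \<delta>" using near by linarith+
      then show "((\<lambda>t. f ?x t) has_vector_derivative \<i> * d ?x t) (at t)" using z by (intro deriv_y)
      have "norm (d ?x t - d ?x ?y) \<le> e / 2" using t near z \<delta>(1) by (intro \<delta>(2)) auto
      then show "norm (\<i> * d ?x t - \<i> * d ?x ?y) \<le> e / 2"
        by (simp add: right_diff_distrib[symmetric] norm_mult)
    qed
    have "w - z = of_real (?u - ?x) + \<i> * of_real (?v - ?y)"
      by (simp add: complex_eq_iff)
    then have "d ?x ?y * (w - z) = (?u - ?x) *\<^sub>R d ?x ?y + (?v - ?y) *\<^sub>R (\<i> * d ?x ?y)"
      by (simp only: scaleR_conv_of_real distrib_left mult.commute mult.left_commute)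
    then have "f ?u ?v - f ?x ?y - d ?x ?y * (w - z)
        = (f ?u ?v - f ?x ?v - (?u - ?x) *\<^sub>R d ?x ?y) + (f ?x ?v - f ?x ?y - (?v - ?y) *\<^sub>R (\<i> * d ?x ?y))"
      by simp
    also have "norm \<dots> \<le> e / 2 * \<bar>?u - ?x\<bar> + e / 2 * \<bar>?v - ?y\<bar>"
      using 1 2 by (rule norm_triangle_le[OF add_mono])
    also have "\<dots> \<le> e / 2 * norm (w - z) + e / 2 * norm (w - z)"
      using le e by (intro add_mono mult_left_mono) auto
    finally show "norm (f ?u ?v - f ?x ?y - d ?x ?y * (w - z)) \<le> e * norm (w - z)" by simp
  qed
qed

text \<open>
  A primitive \<open>F\<close> of \<open>f\<close> is Lipschitz, since its partial derivatives are bounded like \<open>f\<close>. A primitive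
  \<open>G\<close> of \<open>F\<close> then has continuous partial derivatives and is holomorphic, and \<open>F = G'\<close>, \<open>f = F'\<close>.
\<close>

theorem bounded_cauchy_riemann_imp_holomorphic:
  "(\<lambda>z. f (Re z) (Im z)) holomorphic_on {z. \<bar>Re z\<bar> < s \<and> \<bar>Im z\<bar> < s}"
proof -
  have square_open: "open {z. \<bar>Re z\<bar> < b \<and> \<bar>Im z\<bar> < b}" for b :: real
    by (intro open_Collect_conj open_Collect_less continuous_intros)
  have small: "(\<lambda>z. f (Re z) (Im z)) holomorphic_on {z. \<bar>Re z\<bar> < b' \<and> \<bar>Im z\<bar> < b'}"
    if b: "0 < b'" "b' < b" "b < s" for b' b
  proof -
    obtain F M' where F: "cauchy_riemann_square F f b M'"
      using primitive_exists[of b] b by auto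
    interpret F: cauchy_riemann_square F f b M' by (rule F)
    obtain G M'' where G: "cauchy_riemann_square G F b' M''"
      using F.primitive_exists[of b'] b by auto
    interpret G: cauchy_riemann_square G F b' M'' by (rule G)
    have M: "M \<ge> 0" using order.trans[OF norm_ge_zero bounded[of 0 0]] b by auto
    define K where "K = M + 1"
    have K: "K > 0" "M \<le> K" using M by (auto simp: K_def)
    have lip: "norm (F x' y' - F x y) \<le> M * (\<bar>x' - x\<bar> + \<bar>y' - y\<bar>)"
      if "\<bar>x\<bar> < b" "\<bar>y\<bar> < b" "\<bar>x'\<bar> < b" "\<bar>y'\<bar> < b" for x y x' y'
      using that b by (intro F.bounded_partials_imp_Lipschitz bounded) auto
    let ?S = "{z. \<bar>Re z\<bar> < b' \<and> \<bar>Im z\<bar> < b'}"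
    have G': "((\<lambda>z. G (Re z) (Im z)) has_field_derivative F (Re z) (Im z)) (at z)" if "z \<in> ?S" for z
    proof (rule G.continuous_partials_imp_complex_derivative)
      fix x y \<epsilon> :: real assume xy: "\<bar>x\<bar> < b'" "\<bar>y\<bar> < b'" and \<epsilon>: "\<epsilon> > 0"
      have "norm (F x' y' - F x y) \<le> \<epsilon>"
        if x'y': "\<bar>x'\<bar> < b'" "\<bar>y'\<bar> < b'" "\<bar>x' - x\<bar> < \<epsilon> / (2 * K)" "\<bar>y' - y\<bar> < \<epsilon> / (2 * K)" for x' y'
      proof -
        have "norm (F x' y' - F x y) \<le> M * (\<bar>x' - x\<bar> + \<bar>y' - y\<bar>)"
          using xy x'y' b by (intro lip) auto
        also have "\<dots> \<le> K * (\<epsilon> / (2 * K) + \<epsilon> / (2 * K))"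
          using x'y' K by (intro mult_mono add_mono) auto
        also have "\<dots> = \<epsilon>" using K by (simp add: field_simps)
        finally show ?thesis .
      qed
      moreover have "\<epsilon> / (2 * K) > 0" using \<epsilon> K by simp
      ultimately show "\<exists>\<delta>>0. \<forall>x' y'. \<bar>x'\<bar> < b' \<and> \<bar>y'\<bar> < b' \<and> \<bar>x' - x\<bar> < \<delta> \<and> \<bar>y' - y\<bar> < \<delta> \<longrightarrow>
          norm (F x' y' - F x y) \<le> \<epsilon>" by blast
    qed (use that in auto)
    have "(\<lambda>z. F (Re z) (Im z)) holomorphic_on ?S"
    proof (rule holomorphic_transform)
      show "deriv (\<lambda>z. G (Re z) (Im z)) holomorphic_on ?S"
        using G' square_open by (intro holomorphic_deriv) (auto simp: holomorphic_on_open)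
      show "deriv (\<lambda>z. G (Re z) (Im z)) z = F (Re z) (Im z)" if "z \<in> ?S" for z
        using G'[OF that] by (rule DERIV_imp_deriv)
    qed
    note F_hol = this
    show ?thesis
    proof (rule holomorphic_transform)
      show "deriv (\<lambda>z. F (Re z) (Im z)) holomorphic_on ?S"
        using F_hol square_open by (rule holomorphic_deriv)
      fix z assume z: "z \<in> ?S"
      have "((\<lambda>z. F (Re z) (Im z)) has_field_derivative deriv (\<lambda>z. F (Re z) (Im z)) z) (at z)"
        using F_hol square_open z by (rule holomorphic_derivI)
      then have "((\<lambda>z. F (Re z) (Im z)) has_field_derivative deriv (\<lambda>z. F (Re z) (Im z)) z) (at (Complex (Re z) (Im z)))"
        by simp
      moreover have "((\<lambda>t. Complex t (Im z)) has_vector_derivative 1) (at (Re z))"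
      proof -
        have "Complex t (Im z) = of_real t + \<i> * of_real (Im z)" for t by (simp add: complex_eq_iff)
        then show ?thesis by (auto intro!: derivative_eq_intros)
      qed
      ultimately have "(((\<lambda>z. F (Re z) (Im z)) \<circ> (\<lambda>t. Complex t (Im z))) has_vector_derivative
          1 * deriv (\<lambda>z. F (Re z) (Im z)) z) (at (Re z))"
        by (intro field_vector_diff_chain_at)
      then have "((\<lambda>t. F t (Im z)) has_vector_derivative deriv (\<lambda>z. F (Re z) (Im z)) z) (at (Re z))"
        by (simp add: o_def)
      moreover have "((\<lambda>t. F t (Im z)) has_vector_derivative f (Re z) (Im z)) (at (Re z))"
        using z b by (intro F.deriv_x) auto
      ultimately show "deriv (\<lambda>z. F (Re z) (Im z)) z = f (Re z) (Im z)"
        by (rule vector_derivative_unique_at)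
    qed
  qed
  show ?thesis
    unfolding holomorphic_on_def
  proof
    fix z assume z: "z \<in> {z. \<bar>Re z\<bar> < s \<and> \<bar>Im z\<bar> < s}"
    define c where "c = max \<bar>Re z\<bar> \<bar>Im z\<bar>"
    obtain b' where b': "c < b'" "b' < s" using dense[of c s] z by (auto simp: c_def)
    obtain b where b: "b' < b" "b < s" using dense[OF b'(2)] by auto
    have "0 < b'" using b'(1) by (auto simp: c_def)
    have "(\<lambda>z. f (Re z) (Im z)) field_differentiable (at z)"
      using small[OF \<open>0 < b'\<close> b] square_open
      by (rule holomorphic_on_imp_differentiable_at) (use b' in \<open>auto simp: c_def\<close>)
    then show "(\<lambda>z. f (Re z) (Im z)) field_differentiable (at z within {z. \<bar>Re z\<bar> < s \<and> \<bar>Im z\<bar> < s})"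
      by (rule field_differentiable_at_within)
  qed
qed

end

section \<open>Triangular multiplication in the Cartan basis\<close>

context cartan_algebra
begin

lemma functional_add: "functional u (x + y) = functional u x + functional u y"
  and functional_cscale: "functional u (c *\<^sub>C x) = c * functional u x"
proof -
  interpret L: Vector_Spaces.linear cscale "(*)" "functional u" by (rule functional_linear)
  show "functional u (x + y) = functional u x + functional u y" by (rule L.add)
  show "functional u (c *\<^sub>C x) = c * functional u x" by (rule L.scale)
qed

lemma functional_0 [simp]: "functional u 0 = 0"
  using functional_cscale[of u 0 0] by simp

lemma functional_diff: "functional u (x - y) = functional u x - functional u y"
  using functional_add[of u "x - y" y] by simp

lemma functional_scaleR: "functional u (r *\<^sub>R x) = r *\<^sub>R functional u x"
  by (simp add: cscale_of_real[symmetric] functional_cscale scaleR_conv_of_real)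

lemma basis_expansion: "(\<Sum>j = 1..n. functional j x *\<^sub>C I j) = x"
proof -
  have "x \<in> span (I ` {1..n})" using basis_span by simp
  then show ?thesis
  proof (induction rule: span_induct_alt)
    case base
    show ?case by simp
  next
    case (step c b y)
    then obtain s where s: "s \<in> {1..n}" "b = I s" by blast
    have "(\<Sum>j = 1..n. functional j (c *\<^sub>C b + y) *\<^sub>C I j)
        = (\<Sum>j = 1..n. (if j = s then c *\<^sub>C I s else 0) + functional j y *\<^sub>C I j)"
      using s by (intro sum.cong refl)
        (auto simp: functional_add functional_cscale functional_basis scale_left_distrib)
    also have "\<dots> = c *\<^sub>C b + y"
      using s step.IH by (simp add: sum.distrib)
    finally show ?case .
  qed
qed

lemma norm_coordinates: "norm x = sqrt (\<Sum>j = 1..n. (cmod (functional j x))\<^sup>2)"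
  using norm_eq[of "\<lambda>j. functional j x"] unfolding basis_expansion .

lemma norm_functional_le: "j \<in> {1..n} \<Longrightarrow> norm (functional j x) \<le> norm x"
  unfolding norm_coordinates[of x]
  by (rule real_le_rsqrt) (rule member_le_sum[of j "{1..n}" "\<lambda>j. (cmod (functional j x))\<^sup>2"], auto)

lemma bounded_linear_functional: "j \<in> {1..n} \<Longrightarrow> bounded_linear (functional j)"
  by (rule bounded_linear_intro[where K = 1])
    (auto simp: functional_add functional_scaleR norm_functional_le)

lemma norm_cscale: "norm (c *\<^sub>C x) = norm c * norm x"
  unfolding norm_coordinates functional_cscale norm_mult power_mult_distrib
  by (simp add: sum_distrib_left[symmetric] real_sqrt_mult)

lemma bounded_bilinear_cscale: "bounded_bilinear cscale"
proof
  show "\<exists>K. \<forall>c x. norm (c *\<^sub>C x) \<le> norm c * norm x * K"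
    by (intro exI[of _ 1]) (simp add: norm_cscale)
qed (simp_all add: scale_left_distrib scale_right_distrib scaleR_conv_of_real
      cscale_of_real[symmetric] mult.commute)

lemma cscale_mult_right: "a * (c *\<^sub>C b) = c *\<^sub>C (a * b)"
  using cscale_mult_left[of c b a] by (simp add: mult.commute)

lemma bounded_bilinear_times: "bounded_bilinear ((*) :: 'a \<Rightarrow> 'a \<Rightarrow> 'a)"
proof
  have sum_le: "norm (a * b) \<le> norm b * (\<Sum>j = 1..n. norm (a * I j))" for a b
  proof -
    have "a * b = (\<Sum>j = 1..n. functional j b *\<^sub>C (a * I j))"
      by (subst basis_expansion[of b, symmetric]) (simp only: sum_distrib_left cscale_mult_right)
    also have "norm \<dots> \<le> (\<Sum>j = 1..n. norm b * norm (a * I j))"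
      by (rule sum_norm_le) (auto simp: norm_cscale intro!: mult_right_mono norm_functional_le)
    finally show ?thesis by (simp add: sum_distrib_left)
  qed
  show "\<exists>K. \<forall>a b :: 'a. norm (a * b) \<le> norm a * norm b * K"
  proof (intro exI allI)
    fix a b :: 'a
    have "norm (a * I j) \<le> norm a * (\<Sum>k = 1..n. norm (I j * I k))" for j
      using sum_le[of "I j" a] by (simp add: mult.commute)
    then have "(\<Sum>j = 1..n. norm (a * I j)) \<le> norm a * (\<Sum>j = 1..n. \<Sum>k = 1..n. norm (I j * I k))"
      unfolding sum_distrib_left[of "norm a" "\<lambda>j. \<Sum>k = 1..n. norm (I j * I k)"] by (rule sum_mono)
    from mult_left_mono[OF this norm_ge_zero[of b]] sum_le[of a b]
    show "norm (a * b) \<le> norm a * norm b * (\<Sum>j = 1..n. \<Sum>k = 1..n. norm (I j * I k))"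
      by (simp add: ac_simps)
  qed
  fix a b :: 'a and r :: real
  show "r *\<^sub>R a * b = r *\<^sub>R (a * b)" "a * r *\<^sub>R b = r *\<^sub>R (a * b)"
    by (simp_all only: cscale_of_real[symmetric] cscale_mult_left cscale_mult_right)
qed (simp_all add: distrib_left distrib_right)

lemma of_nat_mult_eq_cscale: "of_nat k * x = of_nat k *\<^sub>C x"
  by (induction k) (simp_all add: distrib_right scale_left_distrib)

text \<open>The index \<open>u\<^sub>s\<close> of the one idempotent that acts as the identity on \<open>I s\<close>.\<close>

definition block :: "nat \<Rightarrow> nat" where
  "block s = (if s \<le> m then s else THE u. u \<in> {1..m} \<and> (\<forall>r\<in>{1..m}. I r * I s = (if r = u then I s else 0)))"

lemma block:
  assumes s: "s \<in> {1..n}"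
  shows "block s \<in> {1..m}" "r \<in> {1..m} \<Longrightarrow> I r * I s = (if r = block s then I s else 0)"
proof -
  have "block s \<in> {1..m} \<and> (\<forall>r\<in>{1..m}. I r * I s = (if r = block s then I s else 0))"
  proof (cases "s \<le> m")
    case True
    then show ?thesis using s idempotents by (auto simp: block_def)
  next
    case False
    then have s': "s \<in> {m+1..n}" using s by auto
    have block_eq: "block s = (THE u. u \<in> {1..m} \<and> (\<forall>r\<in>{1..m}. I r * I s = (if r = u then I s else 0)))"
      using False by (simp only: block_def if_False)
    show ?thesis unfolding block_eq by (rule theI'[OF mixed[OF s']])
  qed
  then show "block s \<in> {1..m}" "r \<in> {1..m} \<Longrightarrow> I r * I s = (if r = block s then I s else 0)" by blast+
qed

lemma block_in: "s \<in> {1..n} \<Longrightarrow> block s \<in> {1..n}"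
  using block(1)[of s] m_bounds by auto

lemma block_basis: "s \<in> {1..n} \<Longrightarrow> I (block s) * I s = I s"
  using block by simp

text \<open>
  A descending chain of ideals, spanned by the final segments of the Cartan basis; \<open>flag (Suc m)\<close> is the
  radical of the algebra.
\<close>

definition flag :: "nat \<Rightarrow> 'a set" where
  "flag s = {x. \<forall>r\<in>{1..n}. r < s \<longrightarrow> functional r x = 0}"

lemma flag_0: "0 \<in> flag s"
  and flag_add: "x \<in> flag s \<Longrightarrow> y \<in> flag s \<Longrightarrow> x + y \<in> flag s"
  and flag_diff: "x \<in> flag s \<Longrightarrow> y \<in> flag s \<Longrightarrow> x - y \<in> flag s"
  and flag_cscale: "x \<in> flag s \<Longrightarrow> c *\<^sub>C x \<in> flag s"
  and flag_mono: "x \<in> flag t \<Longrightarrow> s \<le> t \<Longrightarrow> x \<in> flag s"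
  and basis_in_flag: "r \<in> {1..n} \<Longrightarrow> s \<le> r \<Longrightarrow> I r \<in> flag s"
  by (auto simp: flag_def functional_add functional_diff functional_cscale functional_basis)

lemma flag_sum: "(\<And>i. i \<in> A \<Longrightarrow> g i \<in> flag s) \<Longrightarrow> (\<Sum>i\<in>A. g i) \<in> flag s"
  by (induction A rule: infinite_finite_induct) (auto simp: flag_0 flag_add)

lemma flag_beyond: "x \<in> flag s \<Longrightarrow> n < s \<Longrightarrow> x = 0"
  using basis_expansion[of x] by (auto simp: flag_def)

text \<open>
  The multiplication rules of the Cartan basis make the matrix of multiplication by any element
  triangular: the product of \<open>I s\<close> with a nilpotent basis element involves later basis elements only, and
  among the idempotents only the one with index \<open>block s\<close> does not annihilate \<open>I s\<close>.
\<close>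

lemma mult_basis_triangular:
  assumes s: "s \<in> {1..n}"
  shows "y * I s - functional (block s) y *\<^sub>C I s \<in> flag (Suc s)"
proof -
  have "y * I s = (\<Sum>k = 1..n. functional k y *\<^sub>C (I k * I s))"
    by (subst basis_expansion[of y, symmetric]) (simp only: sum_distrib_right cscale_mult_left)
  moreover have "functional (block s) y *\<^sub>C I s = (\<Sum>k = 1..n. if k = block s then functional k y *\<^sub>C I s else 0)"
    using block_in[OF s] by simp
  ultimately have "y * I s - functional (block s) y *\<^sub>C I s
      = (\<Sum>k = 1..n. functional k y *\<^sub>C (I k * I s) - (if k = block s then functional k y *\<^sub>C I s else 0))"
    by (simp only: sum_subtractf)
  also have "\<dots> \<in> flag (Suc s)"
  proof (rule flag_sum)
    fix k assume k: "k \<in> {1..n}"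
    show "functional k y *\<^sub>C (I k * I s) - (if k = block s then functional k y *\<^sub>C I s else 0) \<in> flag (Suc s)"
    proof (cases "k \<le> m")
      case True
      then show ?thesis using k block(2)[OF s, of k] by (simp add: flag_0)
    next
      case False
      then have "k \<noteq> block s" using block(1)[OF s] by auto
      moreover have "I k * I s \<in> flag (Suc s)"
      proof (cases "s \<le> m")
        case True
        then have "I k * I s = (if s = block k then I k else 0)"
          using block(2)[OF k, of s] s by (simp add: mult.commute)
        then show ?thesis using k True False by (auto simp: flag_0 intro!: basis_in_flag)
      next
        case False
        with \<open>\<not> k \<le> m\<close> k s have "I k * I s = (\<Sum>j = max k s + 1..n. \<Upsilon> k j s *\<^sub>C I j)"
          by (intro nilpotents) auto
        also have "\<dots> \<in> flag (Suc s)"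
          by (intro flag_sum flag_cscale basis_in_flag) auto
        finally show ?thesis .
      qed
      ultimately show ?thesis by (simp add: flag_cscale)
    qed
  qed
  finally show ?thesis .
qed

lemma flag_mult:
  assumes x: "x \<in> flag s"
  shows "y * x \<in> flag s"
proof -
  have "y * x = (\<Sum>j = 1..n. functional j x *\<^sub>C (y * I j))"
    by (subst basis_expansion[of x, symmetric]) (simp only: sum_distrib_left cscale_mult_right)
  also have "\<dots> \<in> flag s"
  proof (rule flag_sum)
    fix j assume j: "j \<in> {1..n}"
    show "functional j x *\<^sub>C (y * I j) \<in> flag s"
    proof (cases "j < s")
      case True
      then show ?thesis using x j by (simp add: flag_def)
    next
      case False
      have "y * I j - functional (block j) y *\<^sub>C I j \<in> flag s"
        using flag_mono[OF mult_basis_triangular[OF j]] False by simp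
      moreover have "functional (block j) y *\<^sub>C I j \<in> flag s"
        using False by (intro flag_cscale basis_in_flag[OF j]) auto
      ultimately have "y * I j - functional (block j) y *\<^sub>C I j + functional (block j) y *\<^sub>C I j \<in> flag s"
        by (rule flag_add)
      then show ?thesis by (simp add: flag_cscale)
    qed
  qed
  finally show ?thesis .
qed

lemma radical_mult_flag:
  assumes x: "x \<in> flag (Suc m)" and y: "y \<in> flag s"
  shows "x * y \<in> flag (Suc s)"
proof -
  have "x * y = (\<Sum>j = 1..n. functional j y *\<^sub>C (x * I j))"
    by (subst basis_expansion[of y, symmetric]) (simp only: sum_distrib_left cscale_mult_right)
  also have "\<dots> \<in> flag (Suc s)"
  proof (rule flag_sum)
    fix j assume j: "j \<in> {1..n}"
    show "functional j y *\<^sub>C (x * I j) \<in> flag (Suc s)"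
    proof (cases "j < s")
      case True
      then show ?thesis using y j by (simp add: flag_def flag_0)
    next
      case False
      have "functional (block j) x = 0"
        using x block(1)[OF j] m_bounds by (auto simp: flag_def)
      then have "x * I j \<in> flag (Suc j)" using mult_basis_triangular[OF j, of x] by simp
      then show ?thesis using False by (intro flag_cscale) (rule flag_mono, auto)
    qed
  qed
  finally show ?thesis .
qed

text \<open>
  Comparison of diagonal entries. It turns the Gateaux derivative \<open>h * D\<close> into a scalar condition on the
  first coordinate that does not vanish.
\<close>

lemma functional_mult_leading:
  assumes s: "s \<in> {1..n}" and x: "x \<in> flag s"
  shows "functional s (y * x) = functional (block s) y * functional s x"
proof -
  let ?c = "functional s x"
  have "x - ?c *\<^sub>C I s \<in> flag (Suc s)"
    using x s by (auto simp: flag_def functional_diff functional_cscale functional_basis less_Suc_eq)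
  from flag_mult[OF this, of y] have 1: "functional s (y * x) = ?c * functional s (y * I s)"
    using s by (simp add: flag_def right_diff_distrib cscale_mult_right functional_diff functional_cscale)
  have "functional s (y * I s) = functional (block s) y"
    using mult_basis_triangular[OF s, of y] s
    by (simp add: flag_def functional_diff functional_cscale functional_basis)
  with 1 show ?thesis by simp
qed

lemma functional_mult:
  assumes v: "v \<in> {1..m}"
  shows "functional v (x * y) = functional v x * functional v y"
proof -
  have v': "v \<in> {1..n}" "block v = v" using v m_bounds by (auto simp: block_def)
  have I: "I v \<in> flag v" using v' by (intro basis_in_flag) auto
  have "functional v (x * y * I v) = functional v (x * y)"
    using functional_mult_leading[OF v'(1) I, of "x * y"] v' by (simp add: functional_basis)
  moreover have "functional v (x * (y * I v)) = functional v x * functional v y"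
    using functional_mult_leading[OF v'(1) flag_mult[OF I], of x y]
      functional_mult_leading[OF v'(1) I, of y] v' by (simp add: functional_basis)
  ultimately show ?thesis by (simp add: mult.assoc)
qed

text \<open>
  The nilpotent part of the component \<open>x * I u\<close> of \<open>x\<close> in the local algebra with unit \<open>I u\<close>.
\<close>

definition nilpart :: "nat \<Rightarrow> 'a \<Rightarrow> 'a" where
  "nilpart u x = x * I u - functional u x *\<^sub>C I u"

lemma nilpart_in_radical:
  assumes u: "u \<in> {1..m}"
  shows "nilpart u x \<in> flag (Suc m)"
  using u m_bounds
  by (auto simp: flag_def nilpart_def functional_diff functional_cscale functional_mult functional_basis)

lemma nilpart_mult_basis:
  assumes "s \<in> {1..n}"
  shows "nilpart (block s) x * I s = x * I s - functional (block s) x *\<^sub>C I s"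
  using block_basis[OF assms]
  by (simp add: nilpart_def left_diff_distrib cscale_mult_left mult.assoc)

lemma nilpart_power_in_flag:
  assumes s: "s \<in> {1..n}"
  shows "nilpart (block s) x ^ j * I s \<in> flag (s + j)"
proof (induction j)
  case 0
  show ?case using s by (simp add: basis_in_flag)
next
  case (Suc j)
  from radical_mult_flag[OF nilpart_in_radical[OF block(1)[OF s]] this] show ?case
    by (simp add: mult.assoc)
qed

lemma bounded_linear_nilpart:
  assumes u: "u \<in> {1..n}"
  shows "bounded_linear (nilpart u)"
  unfolding nilpart_def
  by (intro bounded_linear_sub bounded_linear_compose[OF _ bounded_linear_functional[OF u]]
      bounded_bilinear.bounded_linear_left[OF bounded_bilinear_times]
      bounded_bilinear.bounded_linear_left[OF bounded_bilinear_cscale])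

text \<open>
  The value of the holomorphic functional calculus of \<open>F\<close> at \<open>x\<close>, multiplied by \<open>I s\<close>. The Taylor series
  stops before the power \<open>n\<close>, since this power of the nilpotent part annihilates \<open>I s\<close>.
\<close>

definition taylor_lift :: "nat \<Rightarrow> (complex \<Rightarrow> complex) \<Rightarrow> 'a \<Rightarrow> 'a" where
  "taylor_lift s F x = (\<Sum>j<n. ((deriv ^^ j) F (functional (block s) x) / fact j) *\<^sub>C
     (nilpart (block s) x ^ j * I s))"

lemma taylor_lift_leading:
  assumes s: "s \<in> {1..n}"
  shows "taylor_lift s F x - F (functional (block s) x) *\<^sub>C I s \<in> flag (Suc s)"
proof -
  obtain p where p: "n = Suc p" using s by (cases n) auto
  have split: "(\<Sum>j<n. g j) = g 0 + (\<Sum>j<p. g (Suc j))" for g :: "nat \<Rightarrow> 'a"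
    unfolding p by (rule sum.lessThan_Suc_shift)
  have "taylor_lift s F x - F (functional (block s) x) *\<^sub>C I s
      = (\<Sum>j<p. ((deriv ^^ Suc j) F (functional (block s) x) / fact (Suc j)) *\<^sub>C
         (nilpart (block s) x ^ Suc j * I s))"
    unfolding taylor_lift_def split by simp
  also have "\<dots> \<in> flag (Suc s)"
    by (intro flag_sum flag_cscale flag_mono[OF nilpart_power_in_flag[OF s]]) auto
  finally show ?thesis .
qed

lemma has_derivative_nilpart_power:
  assumes u: "u \<in> {1..n}"
  shows "((\<lambda>x. nilpart u x ^ j * b) has_derivative
    (\<lambda>h. of_nat j * (nilpart u h * (nilpart u x ^ (j - 1) * b)))) (at x)"
proof (induction j)
  case 0
  show ?case by simp
next
  case (Suc j)
  have "((\<lambda>x. nilpart u x * (nilpart u x ^ j * b)) has_derivative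
      (\<lambda>h. nilpart u x * (of_nat j * (nilpart u h * (nilpart u x ^ (j - 1) * b)))
        + nilpart u h * (nilpart u x ^ j * b))) (at x)"
    by (rule bounded_bilinear.FDERIV[OF bounded_bilinear_times
          bounded_linear_imp_has_derivative[OF bounded_linear_nilpart[OF u]] Suc.IH])
  moreover have "nilpart u x * (of_nat j * (nilpart u h * (nilpart u x ^ (j - 1) * b)))
        + nilpart u h * (nilpart u x ^ j * b) = of_nat (Suc j) * (nilpart u h * (nilpart u x ^ j * b))" for h
    by (cases j) (simp_all add: algebra_simps)
  ultimately show ?case by (simp add: mult.assoc)
qed

text \<open>
  Differentiating a summand gives one term from the coefficient and one from the power of the nilpotent
  part. After a shift of the index in the latter both carry the same coefficient, and they combine because
  \<open>functional u h *\<^sub>C I s + nilpart u h * I s = h * I s\<close>.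
\<close>

lemma has_derivative_taylor_lift:
  assumes s: "s \<in> {1..n}" and F: "F holomorphic_on S" "open S" "functional (block s) x \<in> S"
  shows "(taylor_lift s F has_derivative (\<lambda>h. h * taylor_lift s (deriv F) x)) (at x)"
proof -
  define u where "u = block s"
  have u: "u \<in> {1..n}" using block_in[OF s] by (simp add: u_def)
  define c where "c j = (deriv ^^ j) F (functional u x)" for j
  let ?P = "\<lambda>j. nilpart u x ^ j * I s"
  have coeff: "((\<lambda>y. (deriv ^^ j) F (functional u y) / fact j) has_derivative
      (\<lambda>h. c (Suc j) / fact j * functional u h)) (at x)" for j
  proof -
    have "((deriv ^^ j) F has_field_derivative (deriv ^^ Suc j) F (functional u x)) (at (functional u x))"
      using holomorphic_derivI[OF holomorphic_higher_deriv[OF F(1,2)] F(2) F(3)] by (simp add: u_def)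
    then have "((deriv ^^ j) F has_derivative (\<lambda>z. c (Suc j) * z)) (at (functional u x))"
      by (simp add: has_field_derivative_def c_def)
    from has_derivative_compose[OF bounded_linear_imp_has_derivative[OF bounded_linear_functional[OF u]] this]
    have "((\<lambda>y. (deriv ^^ j) F (functional u y)) has_derivative (\<lambda>h. c (Suc j) * functional u h)) (at x)" .
    from bounded_linear.has_derivative[OF bounded_linear_divide[of "fact j"] this] show ?thesis by simp
  qed
  have "(taylor_lift s F has_derivative (\<lambda>h. \<Sum>j<n. (c j / fact j) *\<^sub>C (of_nat j * (nilpart u h * ?P (j - 1)))
      + (c (Suc j) / fact j * functional u h) *\<^sub>C ?P j)) (at x)"
    unfolding taylor_lift_def[abs_def] u_def[symmetric] c_def
    by (intro has_derivative_sum bounded_bilinear.FDERIV[OF bounded_bilinear_cscale]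
        coeff[unfolded c_def] has_derivative_nilpart_power u)
  moreover have "(\<Sum>j<n. (c j / fact j) *\<^sub>C (of_nat j * (nilpart u h * ?P (j - 1)))
      + (c (Suc j) / fact j * functional u h) *\<^sub>C ?P j) = h * taylor_lift s (deriv F) x" for h
  proof -
    obtain p where p: "n = Suc p" using s by (cases n) auto
    have split: "(\<Sum>j<n. g j) = g 0 + (\<Sum>j<p. g (Suc j))" "(\<Sum>j<n. g j) = (\<Sum>j<p. g j) + g p"
      for g :: "nat \<Rightarrow> 'a"
      unfolding p by (rule sum.lessThan_Suc_shift, rule sum.lessThan_Suc)
    \<comment> \<open>The shifted sum lacks the summand with index \<open>p\<close>, which vanishes.\<close>
    have top: "nilpart u h * ?P p = 0"
    proof (rule flag_beyond)
      show "nilpart u h * ?P p \<in> flag (Suc (s + p))"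
        unfolding u_def by (intro radical_mult_flag nilpart_in_radical block(1) nilpart_power_in_flag s)
    qed (use s p in auto)
    have "(\<Sum>j<n. (c j / fact j) *\<^sub>C (of_nat j * (nilpart u h * ?P (j - 1))))
        = (\<Sum>j<p. (c (Suc j) / fact j) *\<^sub>C (nilpart u h * ?P j))"
    proof -
      have "c (Suc j) / fact (Suc j) * (of_nat (Suc j)) = c (Suc j) / fact j" for j
        by (simp add: field_simps del: of_nat_Suc)
      then show ?thesis
        unfolding split(1) of_nat_mult_eq_cscale scale_scale by simp
    qed
    also have "\<dots> = (\<Sum>j<n. (c (Suc j) / fact j) *\<^sub>C (nilpart u h * ?P j))"
      unfolding split(2) by (simp add: top)
    finally have "(\<Sum>j<n. (c j / fact j) *\<^sub>C (of_nat j * (nilpart u h * ?P (j - 1)))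
        + (c (Suc j) / fact j * functional u h) *\<^sub>C ?P j)
        = (\<Sum>j<n. (c (Suc j) / fact j) *\<^sub>C (nilpart u h * ?P j + functional u h *\<^sub>C ?P j))"
      by (simp add: sum.distrib scale_right_distrib)
    also have "\<dots> = (\<Sum>j<n. (c (Suc j) / fact j) *\<^sub>C (h * ?P j))"
    proof -
      have "nilpart u h * I s + functional u h *\<^sub>C I s = h * I s"
        using nilpart_mult_basis[OF s, of h] by (simp add: u_def)
      moreover have "nilpart u h * ?P j + functional u h *\<^sub>C ?P j
          = nilpart u x ^ j * (nilpart u h * I s + functional u h *\<^sub>C I s)" for j
        by (simp add: algebra_simps cscale_mult_right)
      ultimately show ?thesis by (simp add: mult.left_commute)
    qed
    also have "\<dots> = h * taylor_lift s (deriv F) x"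
      unfolding taylor_lift_def u_def[symmetric] sum_distrib_left cscale_mult_right c_def
      by (simp add: funpow_swap1)
    finally show ?thesis .
  qed
  ultimately show ?thesis by simp
qed

end

section \<open>Scalar functions with complex-linear directional derivatives\<close>

lemma has_vector_derivative_if_one_sided:
  fixes g :: "real \<Rightarrow> 'a::real_normed_vector"
  assumes right: "((\<lambda>t. (g t - g 0) /\<^sub>R t) \<longlongrightarrow> L) (at_right 0)"
    and left: "((\<lambda>t. (g (- t) - g 0) /\<^sub>R t) \<longlongrightarrow> - L) (at_right 0)"
  shows "(g has_vector_derivative L) (at 0)"
proof -
  have "((\<lambda>t. - ((g (- t) - g 0) /\<^sub>R t)) \<longlongrightarrow> - (- L)) (at_right 0)"
    by (rule tendsto_minus[OF left])
  then have "((\<lambda>t. (g t - g 0) /\<^sub>R t) \<longlongrightarrow> L) (at_left 0)"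
    by (simp add: filterlim_at_left_to_right)
  with right have "((\<lambda>t. (g t - g 0) /\<^sub>R t) \<longlongrightarrow> L) (at 0)"
    by (simp add: filterlim_split_at)
  then have "((\<lambda>t. norm ((g t - g 0) /\<^sub>R t - L)) \<longlongrightarrow> 0) (at 0)"
    by (intro tendsto_norm_zero) (simp add: LIM_zero)
  moreover have "norm ((g t - g 0) /\<^sub>R t - L) = norm (g (0 + t) - g 0 - t *\<^sub>R L) / norm t" if "t \<noteq> 0" for t
  proof -
    have "(g t - g 0) /\<^sub>R t - L = (g t - g 0 - t *\<^sub>R L) /\<^sub>R t"
      using that by (simp add: scaleR_diff_right)
    then show ?thesis by (simp add: divide_inverse mult.commute)
  qed
  ultimately have "((\<lambda>t. norm (g (0 + t) - g 0 - t *\<^sub>R L) / norm t) \<longlongrightarrow> 0) (at 0)"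
    by (simp cong: LIM_cong)
  then show ?thesis
    unfolding has_vector_derivative_def has_derivative_at by (simp add: bounded_linear_scaleR_left)
qed

lemma has_vector_derivative_on_line:
  fixes \<phi> :: "'a::real_normed_vector \<Rightarrow> 'b::real_normed_vector"
  assumes "((\<lambda>\<delta>. (\<phi> (\<zeta> + t *\<^sub>R h + \<delta> *\<^sub>R h) - \<phi> (\<zeta> + t *\<^sub>R h)) /\<^sub>R \<delta>) \<longlongrightarrow> L) (at_right 0)"
    and "((\<lambda>\<delta>. (\<phi> (\<zeta> + t *\<^sub>R h + \<delta> *\<^sub>R (- h)) - \<phi> (\<zeta> + t *\<^sub>R h)) /\<^sub>R \<delta>) \<longlongrightarrow> - L) (at_right 0)"
  shows "((\<lambda>t. \<phi> (\<zeta> + t *\<^sub>R h)) has_vector_derivative L) (at t)"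
proof -
  have "((\<lambda>\<delta>. \<phi> (\<zeta> + t *\<^sub>R h + \<delta> *\<^sub>R h)) has_vector_derivative L) (at (t - t))"
    using assms by (simp add: has_vector_derivative_if_one_sided)
  then have "((\<lambda>\<delta>. \<phi> (\<zeta> + t *\<^sub>R h + \<delta> *\<^sub>R h)) \<circ> (\<lambda>v. v - t) has_vector_derivative 1 *\<^sub>R L) (at t)"
    by (intro vector_diff_chain_at) (auto intro!: derivative_eq_intros)
  then show ?thesis by (simp add: o_def algebra_simps)
qed

text \<open>
  Directional derivatives of the form \<open>f h * c\<close> vanish along the kernel of \<open>f\<close>, so \<open>\<phi>\<close> is constant on
  the fibres of \<open>f\<close> in a ball. On the plane spanned by \<open>p\<close> and \<open>q\<close>, which \<open>f\<close> identifies with \<open>\<complex>\<close>, they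
  are the Cauchy-Riemann equation.
\<close>

lemma factor_through_functional:
  fixes f \<phi> :: "'a::real_normed_vector \<Rightarrow> complex"
  assumes E: "subspace E" and f: "bounded_linear f"
    and p: "p \<in> E" "f p = 1" and q: "q \<in> E" "f q = \<i>"
    and \<zeta>0: "\<zeta>0 \<in> E" and r: "r > 0"
    and bd: "\<And>\<zeta>. \<zeta> \<in> E \<inter> ball \<zeta>0 r \<Longrightarrow> norm (\<phi> \<zeta>) \<le> M"
    and diff: "\<And>\<zeta>. \<zeta> \<in> E \<inter> ball \<zeta>0 r \<Longrightarrow>
      \<exists>c. \<forall>h\<in>E. ((\<lambda>\<delta>. (\<phi> (\<zeta> + \<delta> *\<^sub>R h) - \<phi> \<zeta>) /\<^sub>R \<delta>) \<longlongrightarrow> f h * c) (at_right 0)"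
  obtains \<rho> S F where "0 < \<rho>" "\<rho> \<le> r" "open S" "F holomorphic_on S"
    "\<And>\<zeta>. \<zeta> \<in> E \<inter> ball \<zeta>0 \<rho> \<Longrightarrow> f \<zeta> \<in> S \<and> \<phi> \<zeta> = F (f \<zeta>)"
proof -
  interpret f: bounded_linear f by (rule f)
  obtain c where c: "\<And>\<zeta> h. \<zeta> \<in> E \<inter> ball \<zeta>0 r \<Longrightarrow> h \<in> E \<Longrightarrow>
      ((\<lambda>\<delta>. (\<phi> (\<zeta> + \<delta> *\<^sub>R h) - \<phi> \<zeta>) /\<^sub>R \<delta>) \<longlongrightarrow> f h * c \<zeta>) (at_right 0)"
    using diff by metis
  have line: "((\<lambda>t. \<phi> (\<zeta> + t *\<^sub>R h)) has_vector_derivative f h * c (\<zeta> + t *\<^sub>R h)) (at t)"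
    if "\<zeta> \<in> E" "h \<in> E" "\<zeta> + t *\<^sub>R h \<in> ball \<zeta>0 r" for \<zeta> h t
  proof (rule has_vector_derivative_on_line)
    have W: "\<zeta> + t *\<^sub>R h \<in> E \<inter> ball \<zeta>0 r"
      using that E by (auto intro: subspace_add subspace_scale)
    show "((\<lambda>\<delta>. (\<phi> (\<zeta> + t *\<^sub>R h + \<delta> *\<^sub>R h) - \<phi> (\<zeta> + t *\<^sub>R h)) /\<^sub>R \<delta>) \<longlongrightarrow> f h * c (\<zeta> + t *\<^sub>R h)) (at_right 0)"
      by (rule c[OF W that(2)])
    have "- h \<in> E" using E that(2) by (rule subspace_neg)
    from c[OF W this]
    show "((\<lambda>\<delta>. (\<phi> (\<zeta> + t *\<^sub>R h + \<delta> *\<^sub>R (- h)) - \<phi> (\<zeta> + t *\<^sub>R h)) /\<^sub>R \<delta>) \<longlongrightarrow> - (f h * c (\<zeta> + t *\<^sub>R h))) (at_right 0)"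
      by (simp add: f.neg)
  qed
  have fibre: "\<phi> \<zeta> = \<phi> \<zeta>'"
    if \<zeta>: "\<zeta> \<in> E \<inter> ball \<zeta>0 r" "\<zeta>' \<in> E \<inter> ball \<zeta>0 r" "f \<zeta> = f \<zeta>'" for \<zeta> \<zeta>'
  proof -
    have "norm (\<phi> (\<zeta> + 1 *\<^sub>R (\<zeta>' - \<zeta>)) - \<phi> (\<zeta> + 0 *\<^sub>R (\<zeta>' - \<zeta>)) - (1 - 0) *\<^sub>R 0) \<le> 0 * \<bar>1 - 0\<bar>"
    proof (rule vector_derivative_deviation_bound[where g = "\<lambda>t. \<phi> (\<zeta> + t *\<^sub>R (\<zeta>' - \<zeta>))" and g' = "\<lambda>_. 0"])
      fix t :: real assume t: "t \<in> closed_segment 0 1"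
      have "(1 - t) *\<^sub>R \<zeta> + t *\<^sub>R \<zeta>' \<in> ball \<zeta>0 r"
        using t \<zeta> by (intro convexD[OF convex_ball]) (auto simp: closed_segment_eq_real_ivl)
      then have "\<zeta> + t *\<^sub>R (\<zeta>' - \<zeta>) \<in> ball \<zeta>0 r" by (simp add: algebra_simps)
      from line[OF _ _ this] \<zeta> E show "((\<lambda>t. \<phi> (\<zeta> + t *\<^sub>R (\<zeta>' - \<zeta>))) has_vector_derivative 0) (at t)"
        by (simp add: f.diff subspace_diff)
    qed simp
    then show ?thesis by simp
  qed
  define s where "s = r / (norm p + norm q + 1)"
  have den: "norm p + norm q + 1 > 0" by (simp add: add_nonneg_pos)
  have s: "s > 0" using r den by (simp add: s_def)
  have plane: "\<zeta>0 + x *\<^sub>R p + y *\<^sub>R q \<in> E \<inter> ball \<zeta>0 r" if "\<bar>x\<bar> < s" "\<bar>y\<bar> < s" for x y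
  proof -
    have "norm (x *\<^sub>R p + y *\<^sub>R q) \<le> \<bar>x\<bar> * norm p + \<bar>y\<bar> * norm q"
      by (rule norm_triangle_le) simp
    also have "\<dots> \<le> s * norm p + s * norm q"
      using that by (intro add_mono mult_right_mono) auto
    also have "\<dots> < s * (norm p + norm q + 1)" using s by (simp add: algebra_simps)
    also have "\<dots> = r" using den by (simp add: s_def)
    finally have "dist \<zeta>0 (\<zeta>0 + x *\<^sub>R p + y *\<^sub>R q) < r"
      using norm_minus_cancel[of "x *\<^sub>R p + y *\<^sub>R q"] by (simp add: dist_norm algebra_simps)
    then show ?thesis
      using E \<zeta>0 p(1) q(1) by (auto intro!: subspace_add subspace_scale)
  qed
  define g where "g x y = \<phi> (\<zeta>0 + x *\<^sub>R p + y *\<^sub>R q)" for x y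
  interpret g: cauchy_riemann_square g "\<lambda>x y. c (\<zeta>0 + x *\<^sub>R p + y *\<^sub>R q)" s M
  proof
    fix x y :: real assume xy: "\<bar>x\<bar> < s" "\<bar>y\<bar> < s"
    note W = plane[OF xy]
    have "((\<lambda>t. \<phi> ((\<zeta>0 + y *\<^sub>R q) + t *\<^sub>R p)) has_vector_derivative f p * c ((\<zeta>0 + y *\<^sub>R q) + x *\<^sub>R p)) (at x)"
      using W E \<zeta>0 p q by (intro line) (auto intro!: subspace_add subspace_scale simp: add_ac)
    then show "((\<lambda>t. g t y) has_vector_derivative c (\<zeta>0 + x *\<^sub>R p + y *\<^sub>R q)) (at x)"
      using p(2) by (simp add: g_def add_ac)
    have "((\<lambda>t. \<phi> ((\<zeta>0 + x *\<^sub>R p) + t *\<^sub>R q)) has_vector_derivative f q * c ((\<zeta>0 + x *\<^sub>R p) + y *\<^sub>R q)) (at y)"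
      using W E \<zeta>0 p q by (intro line) (auto intro!: subspace_add subspace_scale)
    then show "((\<lambda>t. g x t) has_vector_derivative \<i> * c (\<zeta>0 + x *\<^sub>R p + y *\<^sub>R q)) (at y)"
      using q(2) by (simp add: g_def)
    show "norm (g x y) \<le> M" unfolding g_def by (rule bd[OF W])
  qed
  define F where "F z = g (Re (z - f \<zeta>0)) (Im (z - f \<zeta>0))" for z
  define S where "S = {z. \<bar>Re (z - f \<zeta>0)\<bar> < s \<and> \<bar>Im (z - f \<zeta>0)\<bar> < s}"
  obtain K where K: "K > 0" "\<And>x. norm (f x) \<le> norm x * K"
    using f.pos_bounded by blast
  show ?thesis
  proof (rule that[of "min r (s / K)" S F])
    show "0 < min r (s / K)" "min r (s / K) \<le> r" using r s K by auto
    show "open S" unfolding S_def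
      by (intro open_Collect_conj open_Collect_less continuous_intros)
    have "(\<lambda>z. g (Re z) (Im z)) \<circ> (\<lambda>z. z - f \<zeta>0) holomorphic_on S"
      by (rule holomorphic_on_compose_gen[OF _ g.bounded_cauchy_riemann_imp_holomorphic]) (auto intro!: holomorphic_intros simp: S_def)
    then show "F holomorphic_on S" by (simp add: o_def F_def[abs_def])
    fix \<zeta> assume \<zeta>: "\<zeta> \<in> E \<inter> ball \<zeta>0 (min r (s / K))"
    define w where "w = f \<zeta> - f \<zeta>0"
    have "norm w \<le> norm (\<zeta> - \<zeta>0) * K" using K(2)[of "\<zeta> - \<zeta>0"] by (simp add: w_def f.diff)
    also have "\<dots> < s"
      using \<zeta> K(1) by (simp add: dist_norm norm_minus_commute pos_less_divide_eq)
    finally have w: "\<bar>Re w\<bar> < s" "\<bar>Im w\<bar> < s"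
      using abs_Re_le_cmod[of w] abs_Im_le_cmod[of w] by auto
    have "f (\<zeta>0 + Re w *\<^sub>R p + Im w *\<^sub>R q) = f \<zeta>0 + w"
      by (simp add: f.add f.scaleR p(2) q(2) scaleR_conv_of_real complex_eq_iff)
    then have "\<phi> \<zeta> = \<phi> (\<zeta>0 + Re w *\<^sub>R p + Im w *\<^sub>R q)"
      using \<zeta> by (intro fibre plane w) (auto simp: w_def)
    then show "f \<zeta> \<in> S \<and> \<phi> \<zeta> = F (f \<zeta>)"
      using w by (simp add: S_def F_def g_def w_def)
  qed
qed

section \<open>Elimination of the coordinates one after another\<close>

lemma has_derivative_imp_directional_limit:
  fixes \<Phi> :: "'a::real_normed_vector \<Rightarrow> 'b::real_normed_vector"
  assumes "(\<Phi> has_derivative A) (at \<zeta> within E)" and E: "subspace E" "\<zeta> \<in> E" "h \<in> E"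
  shows "((\<lambda>\<delta>. (\<Phi> (\<zeta> + \<delta> *\<^sub>R h) - \<Phi> \<zeta>) /\<^sub>R \<delta>) \<longlongrightarrow> A h) (at_right 0)"
proof (rule tendstoI)
  fix e :: real assume e: "e > 0"
  define e' where "e' = e / (norm h + 1)"
  have h1: "norm h + 1 > 0" by (simp add: add_nonneg_pos)
  have e': "e' > 0" using e h1 by (simp add: e'_def)
  interpret A: bounded_linear A using assms(1) by (rule has_derivative_bounded_linear)
  obtain d where d: "d > 0" "\<And>y. y \<in> E \<Longrightarrow> norm (y - \<zeta>) < d \<Longrightarrow>
      norm (\<Phi> y - \<Phi> \<zeta> - A (y - \<zeta>)) \<le> e' * norm (y - \<zeta>)"
    using assms(1) e' unfolding has_derivative_within_alt by blast
  have "\<forall>\<^sub>F \<delta> in at_right 0. \<delta> \<in> {0<..<d / (norm h + 1)}"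
    using d(1) h1 by (intro eventually_at_right_real) simp
  then show "\<forall>\<^sub>F \<delta> in at_right 0. dist ((\<Phi> (\<zeta> + \<delta> *\<^sub>R h) - \<Phi> \<zeta>) /\<^sub>R \<delta>) (A h) < e"
  proof eventually_elim
    case (elim \<delta>)
    then have \<delta>: "\<delta> > 0" "\<delta> * (norm h + 1) < d" using h1 by (auto simp: field_simps)
    have "\<delta> * norm h < d" using \<delta> by (simp add: distrib_left)
    then have "norm (\<Phi> (\<zeta> + \<delta> *\<^sub>R h) - \<Phi> \<zeta> - A (\<delta> *\<^sub>R h)) \<le> e' * (\<delta> * norm h)"
      using d(2)[of "\<zeta> + \<delta> *\<^sub>R h"] \<delta>(1) E by (auto simp: subspace_add subspace_scale)
    moreover have "\<Phi> (\<zeta> + \<delta> *\<^sub>R h) - \<Phi> \<zeta> - A (\<delta> *\<^sub>R h) = \<delta> *\<^sub>R ((\<Phi> (\<zeta> + \<delta> *\<^sub>R h) - \<Phi> \<zeta>) /\<^sub>R \<delta> - A h)"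
      using \<delta>(1) by (simp add: A.scaleR scaleR_diff_right)
    ultimately have "\<delta> * norm ((\<Phi> (\<zeta> + \<delta> *\<^sub>R h) - \<Phi> \<zeta>) /\<^sub>R \<delta> - A h) \<le> \<delta> * (e' * norm h)"
      using \<delta>(1) by (simp add: mult_ac)
    then have "norm ((\<Phi> (\<zeta> + \<delta> *\<^sub>R h) - \<Phi> \<zeta>) /\<^sub>R \<delta> - A h) \<le> e' * norm h"
      using \<delta>(1) by simp
    also have "\<dots> < e' * (norm h + 1)" using e' by (simp add: algebra_simps)
    also have "\<dots> = e" using h1 by (simp add: e'_def)
    finally show ?case by (simp add: dist_norm)
  qed
qed

context cartan_algebra
begin

lemma bounded_linear_times_left: "bounded_linear (\<lambda>h :: 'a. h * D)"
  by (rule bounded_bilinear.bounded_linear_left[OF bounded_bilinear_times])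

text \<open>
  Downward induction on \<open>s\<close>: the coordinate at \<open>s\<close> is removed by subtracting a Taylor lift, which is
  Frechet differentiable with a derivative of the required form, and the difference has values in
  the next ideal of the chain. At \<open>s = n + 1\<close> only the zero function is left. The unit belongs to \<open>E\<close>, so
  \<open>D\<close> is itself a directional derivative and inherits the vanishing coordinates of \<open>\<Phi>\<close>.
\<close>

lemma gateaux_imp_has_derivative_flag:
  fixes E :: "'a set"
  assumes E: "Real_Vector_Spaces.subspace E" "1 \<in> E" and surj: "\<forall>u\<in>{1..m}. functional u ` E = UNIV"
    and \<zeta>0: "\<zeta>0 \<in> E" and s: "s \<le> Suc n" "1 \<le> s"
  shows "\<lbrakk>r > 0; \<And>\<zeta>. \<zeta> \<in> E \<inter> ball \<zeta>0 r \<Longrightarrow> \<Phi> \<zeta> \<in> flag s;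
      \<And>\<zeta>. \<zeta> \<in> E \<inter> ball \<zeta>0 r \<Longrightarrow> norm (\<Phi> \<zeta>) \<le> M;
      \<And>\<zeta>. \<zeta> \<in> E \<inter> ball \<zeta>0 r \<Longrightarrow> gateaux_differentiable_at E \<Phi> \<zeta>\<rbrakk>
    \<Longrightarrow> \<exists>D. (\<Phi> has_derivative (\<lambda>h. h * D)) (at \<zeta>0 within E)"
  using s
proof (induction s arbitrary: \<Phi> r M rule: inc_induct)
  case base
  have "((\<lambda>_. 0) has_derivative (\<lambda>h. h * 0)) (at \<zeta>0 within E)" by simp
  then have "(\<Phi> has_derivative (\<lambda>h. h * 0)) (at \<zeta>0 within E)"
    using base.prems(1,2) \<zeta>0 flag_beyond
    by (elim has_derivative_transform_within[where d = r]) (auto simp: dist_commute)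
  then show ?case by blast
next
  case (step s)
  let ?W = "E \<inter> ball \<zeta>0 r"
  have s: "s \<in> {1..n}" using step.hyps step.prems by auto
  define u where "u = block s"
  have u: "u \<in> {1..m}" "u \<in> {1..n}" using block(1)[OF s] block_in[OF s] by (auto simp: u_def)
  obtain p q where pq: "p \<in> E" "functional u p = 1" "q \<in> E" "functional u q = \<i>"
  proof -
    have "1 \<in> functional u ` E" "\<i> \<in> functional u ` E" using surj u(1) by auto
    then show ?thesis using that by (metis imageE)
  qed
  have lim: "((\<lambda>\<delta>. (functional j (\<Phi> (\<zeta> + \<delta> *\<^sub>R h)) - functional j (\<Phi> \<zeta>)) /\<^sub>R \<delta>) \<longlongrightarrow> functional j (h * D)) (at_right 0)"
    if "((\<lambda>\<delta>. (\<Phi> (\<zeta> + \<delta> *\<^sub>R h) - \<Phi> \<zeta>) /\<^sub>R \<delta>) \<longlongrightarrow> h * D) (at_right 0)" "j \<in> {1..n}" for \<zeta> h D j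
    using bounded_linear.tendsto[OF bounded_linear_functional[OF that(2)] that(1)]
    by (simp add: functional_diff functional_scaleR)
  have "\<exists>c. \<forall>h\<in>E. ((\<lambda>\<delta>. (functional s (\<Phi> (\<zeta> + \<delta> *\<^sub>R h)) - functional s (\<Phi> \<zeta>)) /\<^sub>R \<delta>)
      \<longlongrightarrow> functional u h * c) (at_right 0)" if \<zeta>: "\<zeta> \<in> ?W" for \<zeta>
  proof -
    obtain D where D: "\<And>h. h \<in> E \<Longrightarrow> ((\<lambda>\<delta>. (\<Phi> (\<zeta> + \<delta> *\<^sub>R h) - \<Phi> \<zeta>) /\<^sub>R \<delta>) \<longlongrightarrow> h * D) (at_right 0)"
      using step.prems(4)[OF \<zeta>] unfolding gateaux_differentiable_at_def by blast
    have "functional j D = 0" if j: "j \<in> {1..n}" "j < s" for j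
    proof (rule tendsto_unique)
      show "at_right (0::real) \<noteq> bot" by simp
      show "((\<lambda>\<delta>. (functional j (\<Phi> (\<zeta> + \<delta> *\<^sub>R 1)) - functional j (\<Phi> \<zeta>)) /\<^sub>R \<delta>) \<longlongrightarrow> functional j D) (at_right 0)"
        using lim[OF D[OF E(2)] j(1)] by simp
      have "\<forall>\<^sub>F \<delta> in at_right 0. \<zeta> + \<delta> *\<^sub>R 1 \<in> ball \<zeta>0 r"
      proof -
        have "((\<lambda>\<delta>. \<zeta> + \<delta> *\<^sub>R 1) \<longlongrightarrow> \<zeta> + 0 *\<^sub>R 1) (at_right 0)"
          by (intro tendsto_intros)
        then show ?thesis using \<zeta> by (intro topological_tendstoD) auto
      qed
      then have "\<forall>\<^sub>F \<delta> in at_right 0. 0 = (functional j (\<Phi> (\<zeta> + \<delta> *\<^sub>R 1)) - functional j (\<Phi> \<zeta>)) /\<^sub>R \<delta>"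
      proof eventually_elim
        case (elim \<delta>)
        then have "\<zeta> + \<delta> *\<^sub>R 1 \<in> ?W" using E \<zeta> by (auto intro!: real_vector.subspace_add real_vector.subspace_scale)
        from step.prems(2)[OF this] step.prems(2)[OF \<zeta>] show ?case using j by (simp add: flag_def)
      qed
      then show "((\<lambda>\<delta>. (functional j (\<Phi> (\<zeta> + \<delta> *\<^sub>R 1)) - functional j (\<Phi> \<zeta>)) /\<^sub>R \<delta>) \<longlongrightarrow> 0) (at_right 0)"
        by (rule tendsto_eventually[OF eventually_mono]) simp
    qed
    then have "D \<in> flag s" by (simp add: flag_def)
    then have "functional s (h * D) = functional u h * functional s D" for h
      unfolding u_def by (rule functional_mult_leading[OF s])
    then show ?thesis using lim[OF D s] by (intro exI[of _ "functional s D"]) auto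
  qed
  moreover have "norm (functional s (\<Phi> \<zeta>)) \<le> M" if "\<zeta> \<in> ?W" for \<zeta>
    using norm_functional_le[OF s] step.prems(3)[OF that] by (rule order.trans)
  ultimately obtain \<rho> S F where F: "0 < \<rho>" "\<rho> \<le> r" "open S" "F holomorphic_on S"
    "\<And>\<zeta>. \<zeta> \<in> E \<inter> ball \<zeta>0 \<rho> \<Longrightarrow> functional u \<zeta> \<in> S \<and> functional s (\<Phi> \<zeta>) = F (functional u \<zeta>)"
    using factor_through_functional[OF E(1) bounded_linear_functional[OF u(2)] pq \<zeta>0 step.prems(1), of "\<lambda>\<zeta>. functional s (\<Phi> \<zeta>)"]
    by (smt (verit))
  define L where "L = taylor_lift s F"
  have L: "(L has_derivative (\<lambda>h. h * taylor_lift s (deriv F) \<zeta>)) (at \<zeta>)" if "\<zeta> \<in> E \<inter> ball \<zeta>0 \<rho>" for \<zeta>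
    unfolding L_def using has_derivative_taylor_lift[OF s F(4,3)] F(5)[OF that] by (simp add: u_def)
  have in_\<rho>: "\<zeta>0 \<in> E \<inter> ball \<zeta>0 \<rho>" using \<zeta>0 F(1) by simp
  \<comment> \<open>Continuity bounds the lift near \<open>\<zeta>0\<close> only, so the radius shrinks with every step.\<close>
  have "isCont L \<zeta>0" using L[OF in_\<rho>] has_derivative_continuous by blast
  then obtain \<delta> where \<delta>: "\<delta> > 0" "\<And>\<zeta>. dist \<zeta> \<zeta>0 < \<delta> \<Longrightarrow> dist (L \<zeta>) (L \<zeta>0) < 1"
    unfolding continuous_at_eps_delta by (metis zero_less_one)
  have "\<exists>D. ((\<lambda>\<zeta>. \<Phi> \<zeta> - L \<zeta>) has_derivative (\<lambda>h. h * D)) (at \<zeta>0 within E)"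
  proof (rule step.IH)
    show "min \<rho> \<delta> > 0" using F(1) \<delta>(1) by simp
    fix \<zeta> assume "\<zeta> \<in> E \<inter> ball \<zeta>0 (min \<rho> \<delta>)"
    then have \<zeta>: "\<zeta> \<in> E \<inter> ball \<zeta>0 \<rho>" "\<zeta> \<in> ?W" "dist \<zeta> \<zeta>0 < \<delta>" using F(2) by (auto simp: dist_commute)
    have "\<Phi> \<zeta> - F (functional u \<zeta>) *\<^sub>C I s \<in> flag (Suc s)"
      using step.prems(2)[OF \<zeta>(2)] F(5)[OF \<zeta>(1)] s
      by (auto simp: flag_def functional_diff functional_cscale functional_basis less_Suc_eq)
    from flag_diff[OF this taylor_lift_leading[OF s, of F \<zeta>]] show "\<Phi> \<zeta> - L \<zeta> \<in> flag (Suc s)"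
      by (simp add: L_def u_def)
    have "norm (L \<zeta>) \<le> norm (L \<zeta>0) + 1"
      using \<delta>(2)[OF \<zeta>(3)] norm_triangle_ineq2[of "L \<zeta>" "L \<zeta>0"] by (simp add: dist_norm)
    then show "norm (\<Phi> \<zeta> - L \<zeta>) \<le> M + (norm (L \<zeta>0) + 1)"
      using step.prems(3)[OF \<zeta>(2)] by (intro order.trans[OF norm_triangle_ineq4 add_mono])
    obtain D where D: "\<And>h. h \<in> E \<Longrightarrow> ((\<lambda>\<delta>. (\<Phi> (\<zeta> + \<delta> *\<^sub>R h) - \<Phi> \<zeta>) /\<^sub>R \<delta>) \<longlongrightarrow> h * D) (at_right 0)"
      using step.prems(4)[OF \<zeta>(2)] unfolding gateaux_differentiable_at_def by blast
    have "((\<lambda>\<delta>. ((\<Phi> (\<zeta> + \<delta> *\<^sub>R h) - L (\<zeta> + \<delta> *\<^sub>R h)) - (\<Phi> \<zeta> - L \<zeta>)) /\<^sub>R \<delta>)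
        \<longlongrightarrow> h * (D - taylor_lift s (deriv F) \<zeta>)) (at_right 0)" if h: "h \<in> E" for h
      using tendsto_diff[OF D[OF h] has_derivative_imp_directional_limit[OF has_derivative_at_withinI[OF L[OF \<zeta>(1)]] E(1) _ h]] \<zeta>(1)
      by (simp add: algebra_simps)
    then show "gateaux_differentiable_at E (\<lambda>\<zeta>. \<Phi> \<zeta> - L \<zeta>) \<zeta>"
      unfolding gateaux_differentiable_at_def by blast
  qed auto
  then obtain D where "((\<lambda>\<zeta>. \<Phi> \<zeta> - L \<zeta>) has_derivative (\<lambda>h. h * D)) (at \<zeta>0 within E)" by blast
  from has_derivative_add[OF this has_derivative_at_withinI[OF L[OF in_\<rho>]]]
  have "(\<Phi> has_derivative (\<lambda>h. h * (D + taylor_lift s (deriv F) \<zeta>0))) (at \<zeta>0 within E)"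
    by (simp add: distrib_left)
  then show ?case by blast
qed

text \<open>
  As \<open>\<Omega>\<close> is relatively open, small increments in \<open>E\<close> do not leave it, and Lorch differentiability is Frechet
  differentiability along \<open>E\<close> with a derivative given by a multiplication.
\<close>

lemma lorch_differentiable_at_iff:
  fixes E :: "'a set"
  assumes E: "Real_Vector_Spaces.subspace E" and \<Omega>: "openin (top_of_set E) \<Omega>" and \<zeta>: "\<zeta> \<in> \<Omega>"
  shows "lorch_differentiable_at E \<Omega> \<Phi> \<zeta> \<longleftrightarrow> (\<exists>D. (\<Phi> has_derivative (\<lambda>h. h * D)) (at \<zeta> within E))"
proof -
  have sub: "\<Omega> \<subseteq> E" using \<Omega> by (rule openin_imp_subset)
  obtain U where U: "open U" "\<Omega> = E \<inter> U" using \<Omega> by (auto simp: openin_open)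
  have "at \<zeta> within E = at \<zeta> within \<Omega>"
    using U \<zeta> by (intro at_within_nhd[of _ U]) auto
  moreover have "(\<forall>\<epsilon>>0. \<exists>\<delta>>0. \<forall>h\<in>E. norm h < \<delta> \<and> \<zeta> + h \<in> \<Omega> \<longrightarrow>
        norm (\<Phi> (\<zeta> + h) - \<Phi> \<zeta> - h * D) \<le> norm h * \<epsilon>) \<longleftrightarrow>
      (\<Phi> has_derivative (\<lambda>h. h * D)) (at \<zeta> within \<Omega>)" for D
  proof -
    have "(\<forall>h\<in>E. norm h < \<delta> \<and> \<zeta> + h \<in> \<Omega> \<longrightarrow> norm (\<Phi> (\<zeta> + h) - \<Phi> \<zeta> - h * D) \<le> norm h * \<epsilon>)
       \<longleftrightarrow> (\<forall>y\<in>\<Omega>. norm (y - \<zeta>) < \<delta> \<longrightarrow> norm (\<Phi> y - \<Phi> \<zeta> - (y - \<zeta>) * D) \<le> \<epsilon> * norm (y - \<zeta>))" (is "?l \<longleftrightarrow> ?r") for \<delta> \<epsilon>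
    proof
      assume l: ?l
      show ?r
      proof (intro ballI impI)
        fix y assume y: "y \<in> \<Omega>" "norm (y - \<zeta>) < \<delta>"
        have "y - \<zeta> \<in> E" using y \<zeta> sub E by (auto intro: real_vector.subspace_diff)
        with l y show "norm (\<Phi> y - \<Phi> \<zeta> - (y - \<zeta>) * D) \<le> \<epsilon> * norm (y - \<zeta>)"
          by (auto dest!: bspec[of _ _ "y - \<zeta>"] simp: mult.commute)
      qed
    next
      assume ?r
      then show ?l by (auto dest: bspec simp: mult.commute)
    qed
    then show ?thesis
      unfolding has_derivative_within_alt using bounded_linear_times_left[of D] by simp
  qed
  ultimately show ?thesis by (simp add: lorch_differentiable_at_def)
qed

end

lemma subspace_real_hull: "subspace (real_hull k e)"
proof (rule subspaceI)
  show "0 \<in> real_hull k e"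
    unfolding real_hull_def mem_Collect_eq by (intro exI[of _ "\<lambda>_. 0"]) simp
next
  fix a b assume "a \<in> real_hull k e" "b \<in> real_hull k e"
  then obtain x y where "a = (\<Sum>j = 1..k. x j *\<^sub>R e j)" "b = (\<Sum>j = 1..k. y j *\<^sub>R e j)"
    by (auto simp: real_hull_def)
  then have "a + b = (\<Sum>j = 1..k. (x j + y j) *\<^sub>R e j)"
    by (simp add: scaleR_add_left sum.distrib)
  then show "a + b \<in> real_hull k e"
    unfolding real_hull_def mem_Collect_eq by (intro exI[of _ "\<lambda>j. x j + y j"]) simp
next
  fix c a assume "a \<in> real_hull k e"
  then obtain x where "a = (\<Sum>j = 1..k. x j *\<^sub>R e j)"
    by (auto simp: real_hull_def)
  then have "c *\<^sub>R a = (\<Sum>j = 1..k. (c * x j) *\<^sub>R e j)"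
    by (simp add: scaleR_sum_right)
  then show "c *\<^sub>R a \<in> real_hull k e"
    unfolding real_hull_def mem_Collect_eq by (intro exI[of _ "\<lambda>j. c * x j"]) simp
qed

lemma mem_real_hull:
  assumes "i \<in> {1..k}"
  shows "e i \<in> real_hull k e"
proof -
  have "e i = (\<Sum>j = 1..k. (if j = i then 1 else 0) *\<^sub>R e j)"
    using assms by (simp add: if_distrib[of "\<lambda>c. c *\<^sub>R _"] cong: if_cong)
  then show ?thesis
    unfolding real_hull_def mem_Collect_eq by (intro exI[of _ "\<lambda>j. if j = i then 1 else 0"]) simp
qed

theorem theorem1:
  fixes cscale :: "complex \<Rightarrow> 'a::{comm_ring_1, real_normed_vector} \<Rightarrow> 'a"
    and n m k :: nat
    and I e :: "nat \<Rightarrow> 'a"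
    and \<Upsilon> :: "nat \<Rightarrow> nat \<Rightarrow> nat \<Rightarrow> complex"
    and E \<Omega> :: "'a set"
    and \<Phi> :: "'a \<Rightarrow> 'a"
  assumes "cartan_algebra cscale n m I \<Upsilon>"
    and "2 \<le> k" and "k \<le> 2 * n"
    and "e 1 = 1"
    and "inj_on e {1..k}" and "independent (e ` {1..k})"
    and "E = real_hull k e"
    and "\<forall>u\<in>{1..m}. cartan_algebra.functional cscale n I u ` E = (UNIV :: complex set)"
    and "domain_in E \<Omega>"
  shows "(locally_bounded_on \<Omega> \<Phi> \<and> gateaux_differentiable_on E \<Omega> \<Phi> \<longleftrightarrow> monogenic_on E \<Omega> \<Phi>) \<and>
         (monogenic_on E \<Omega> \<Phi> \<longleftrightarrow> lorch_differentiable_on E \<Omega> \<Phi>)"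
proof -
  interpret cartan_algebra cscale n m I \<Upsilon> by fact
  have E: "Real_Vector_Spaces.subspace E" unfolding \<open>E = real_hull k e\<close> by (rule subspace_real_hull)
  have one: "1 \<in> E" using mem_real_hull[of 1 k e] assms(2,4,7) by simp
  have open_\<Omega>: "openin (top_of_set E) \<Omega>" using assms(9) by (simp add: domain_in_def)
  then have sub: "\<Omega> \<subseteq> E" by (rule openin_imp_subset)
  have lorch: "lorch_differentiable_on E \<Omega> \<Phi>"
    if bd: "locally_bounded_on \<Omega> \<Phi>" and diff: "gateaux_differentiable_on E \<Omega> \<Phi>"
    unfolding lorch_differentiable_on_def
  proof
    fix \<zeta> assume \<zeta>: "\<zeta> \<in> \<Omega>"
    obtain U where U: "openin (top_of_set \<Omega>) U" "\<zeta> \<in> U" "bounded (\<Phi> ` U)"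
      using bd \<zeta> unfolding locally_bounded_on_def by blast
    have "openin (top_of_set E) U" using U(1) open_\<Omega> by (rule openin_trans)
    then obtain r where r: "r > 0" "ball \<zeta> r \<inter> E \<subseteq> U"
      using U(2) unfolding openin_contains_ball by blast
    obtain M where M: "\<And>z. z \<in> U \<Longrightarrow> norm (\<Phi> z) \<le> M"
      using U(3) by (auto simp: bounded_iff)
    have "U \<subseteq> \<Omega>" using U(1) by (rule openin_imp_subset)
    have "\<exists>D. (\<Phi> has_derivative (\<lambda>h. h * D)) (at \<zeta> within E)"
    proof (rule gateaux_imp_has_derivative_flag[OF E one assms(8), where s = 1])
      fix z assume "z \<in> E \<inter> ball \<zeta> r"
      then have z: "z \<in> U" using r(2) by auto
      show "\<Phi> z \<in> flag 1" by (auto simp: flag_def)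
      show "norm (\<Phi> z) \<le> M" by (rule M[OF z])
      show "gateaux_differentiable_at E \<Phi> z"
        using diff z \<open>U \<subseteq> \<Omega>\<close> by (auto simp: gateaux_differentiable_on_def)
    qed (use \<zeta> sub r(1) in auto)
    then show "lorch_differentiable_at E \<Omega> \<Phi> \<zeta>"
      by (simp add: lorch_differentiable_at_iff[OF E open_\<Omega> \<zeta>])
  qed
  have monogenic: "monogenic_on E \<Omega> \<Phi>" if L: "lorch_differentiable_on E \<Omega> \<Phi>"
  proof -
    have D: "\<exists>D. (\<Phi> has_derivative (\<lambda>h. h * D)) (at \<zeta> within E)" if "\<zeta> \<in> \<Omega>" for \<zeta>
      using L that lorch_differentiable_at_iff[OF E open_\<Omega> that, of \<Phi>] unfolding lorch_differentiable_on_def by blast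
    have "continuous_on \<Omega> \<Phi>"
      unfolding continuous_on_eq_continuous_within
    proof
      fix \<zeta> assume "\<zeta> \<in> \<Omega>"
      then have "continuous (at \<zeta> within E) \<Phi>" using D has_derivative_continuous by blast
      then show "continuous (at \<zeta> within \<Omega>) \<Phi>" using sub by (rule continuous_within_subset)
    qed
    moreover have "gateaux_differentiable_on E \<Omega> \<Phi>"
      unfolding gateaux_differentiable_on_def gateaux_differentiable_at_def
    proof
      fix \<zeta> assume \<zeta>: "\<zeta> \<in> \<Omega>"
      then obtain A where A: "(\<Phi> has_derivative (\<lambda>h. h * A)) (at \<zeta> within E)" using D by blast
      show "\<exists>D. \<forall>h\<in>E. ((\<lambda>\<delta>. (\<Phi> (\<zeta> + \<delta> *\<^sub>R h) - \<Phi> \<zeta>) /\<^sub>R \<delta>) \<longlongrightarrow> h * D) (at_right 0)"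
        using has_derivative_imp_directional_limit[OF A E] \<zeta> sub by blast
    qed
    ultimately show ?thesis by (simp add: monogenic_on_def)
  qed
  have bounded: "locally_bounded_on \<Omega> \<Phi>" if cont: "continuous_on \<Omega> \<Phi>"
    unfolding locally_bounded_on_def
  proof
    fix \<zeta> assume \<zeta>: "\<zeta> \<in> \<Omega>"
    let ?U = "\<Omega> \<inter> \<Phi> -` ball (\<Phi> \<zeta>) 1"
    have "openin (top_of_set \<Omega>) ?U"
      using cont by (rule continuous_openin_preimage_gen) simp
    moreover have "bounded (\<Phi> ` ?U)"
      by (rule bounded_subset[OF bounded_ball]) auto
    ultimately show "\<exists>U. openin (top_of_set \<Omega>) U \<and> \<zeta> \<in> U \<and> bounded (\<Phi> ` U)"
      using \<zeta> by (intro exI[of _ ?U]) auto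
  qed
  show ?thesis
    using lorch monogenic bounded unfolding monogenic_on_def by blast
qed

end
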